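(* Let $1\le s<n$ and let $A\in\mathbb{R}^{n,n}$ be of tree structure and, for some permutation matrix $P$, of the form $$PAP^T=\begin{bmatrix}A_{1,1}&A_{1,2}\\ A_{2,1}&A_{2,2}\end{bmatrix},$$ where $A_{1,1}\in\mathbb{R}^{s,s}$ is an inverse $N_0$-matrix, $A_{2,2}\in\mathbb{R}^{n-s,n-s}$ is an inverse $M$-matrix, and the off-diagonal blocks are $A_{1,2}=\tau\xi_s\xi_{n-s}^T$ and $A_{2,1}=\tau\xi_{n-s}\xi_s^T$, where $\tau=\tau(A_{1,1})$ is the smallest entry of $A_{1,1}$. Then $A$ is nonsingular and $A^{-1}$ is an acyclic $Z$-matrix with $A^{-1}\in L_{s-1}$.
   Context: $\xi_k$ denotes the vector of all ones in $\mathbb{R}^k$. Tree structure: a weighted rooted tree $\Gamma_{(0)}$ has vertex set $\{0,1,\dots,n\}$, where $0$ is the root, and each edge $\{r,s\}$ carries a real weight $w_{r,s}$. Convention: $\Gamma_{(0)}$ is obtained from a tree $\Gamma$ with vertex set $\{1,\dots,n\}$ by adding the root $0$ and one new edge $\{0,1\}$; the vertices of $\Gamma$ are numbered by a depth-first search starting at vertex $1$. $P_{i,j}$ denotes the unique path (as a set of edges) between vertices $i$ and $j$. A matrix $A=[a_{i,j}]\in\mathbb{R}^{n,n}$ is of tree structure (with respect to $\Gamma_{(0)}$) if for all $i,j=1,\dots,n$, $a_{i,j}=\sum_{\{r,s\}\in P_{i,0}\cap P_{j,0}}w_{r,s}$, the sum being over the common edges of $P_{i,0}$ and $P_{j,0}$.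 A $Z$-matrix is a real square matrix with nonpositive off-diagonal entries. For an entrywise nonnegative $k\times k$ matrix $B$ and $1\le q\le k$, $\rho_q(B)$ is the maximum of the spectral radii of all $q\times q$ principal submatrices of $B$; $\rho_0(B):=-\infty$, $\rho_{k+1}(B):=\infty$. For $k\times k$ matrices and $0\le q\le k$, $L_q$ is the class of real matrices of the form $tI-B$ with $B\ge0$ and $\rho_q(B)\le t<\rho_{q+1}(B)$. For $k\times k$ matrices, $L_k$ is the class of $M$-matrices and $L_{k-1}$ the class of $N_0$-matrices. A $k\times k$ matrix is an inverse $M$-matrix (inverse $N_0$-matrix) if it is nonsingular and its inverse is an $M$-matrix ($N_0$-matrix). In the conclusion, $L_{s-1}$ refers to $n\times n$ matrices. The graph $G(C)$ of an $n\times n$ matrix $C=[c_{i,j}]$ is the undirected graph on $\{1,\dots,n\}$ with an edge between distinct $i,j$ if and only if $c_{i,j}\ne0$ or $c_{j,i}\ne0$. $C$ is acyclic if $G(C)$ is a forest (a tree in the irreducible case). *)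

theory Defs
  imports
    "Jordan_Normal_Form.Matrix"
    "Jordan_Normal_Form.Spectral_Radius"
    "Jordan_Normal_Form.DL_Submatrix"
    "HOL-Library.Extended_Real"
    "HOL-Combinatorics.Permutations"
begin

text \<open>
  A simple undirected graph is given by a vertex set \<open>V\<close> and a set \<open>E\<close> of two-element subsets
  of \<open>V\<close>. The constants \<open>tree\<close> and \<open>forest\<close> of the AFP entry Graph Theory
  are not used: they exclude directed cycles only, and an undirected edge, seen as a pair of
  opposite arcs, already is a directed cycle there.
\<close>

definition simple_graph :: "'a set \<Rightarrow> 'a set set \<Rightarrow> bool" where
  "simple_graph V E \<longleftrightarrow> E \<subseteq> {{u, v} | u v. u \<in> V \<and> v \<in> V \<and> u \<noteq> v}"

definition path_in :: "'a set \<Rightarrow> 'a set set \<Rightarrow> 'a list \<Rightarrow> bool" where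
  "path_in V E p \<longleftrightarrow>
     p \<noteq> [] \<and> distinct p \<and> set p \<subseteq> V \<and> (\<forall>i. Suc i < length p \<longrightarrow> {p ! i, p ! Suc i} \<in> E)"

definition path_between :: "'a set \<Rightarrow> 'a set set \<Rightarrow> 'a \<Rightarrow> 'a \<Rightarrow> 'a list \<Rightarrow> bool" where
  "path_between V E u v p \<longleftrightarrow> path_in V E p \<and> hd p = u \<and> last p = v"

definition cycle_in :: "'a set \<Rightarrow> 'a set set \<Rightarrow> 'a list \<Rightarrow> bool" where
  "cycle_in V E p \<longleftrightarrow> path_in V E p \<and> 3 \<le> length p \<and> {last p, hd p} \<in> E"

definition forest_graph :: "'a set \<Rightarrow> 'a set set \<Rightarrow> bool" where
  "forest_graph V E \<longleftrightarrow> simple_graph V E \<and> \<not> (\<exists>p. cycle_in V E p)"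

definition connected_graph :: "'a set \<Rightarrow> 'a set set \<Rightarrow> bool" where
  "connected_graph V E \<longleftrightarrow> V \<noteq> {} \<and> (\<forall>u\<in>V. \<forall>v\<in>V. \<exists>p. path_between V E u v p)"

definition tree_graph :: "'a set \<Rightarrow> 'a set set \<Rightarrow> bool" where
  "tree_graph V E \<longleftrightarrow> forest_graph V E \<and> connected_graph V E"

definition path_edges :: "'a list \<Rightarrow> 'a set set" where
  "path_edges p = {{p ! i, p ! Suc i} | i. Suc i < length p}"

text \<open>The edge set \<open>P\<^sub>i\<^sub>,\<^sub>j\<close> of the path between \<open>i\<close> and \<open>j\<close>; meaningful only in a tree.\<close>

definition tree_path :: "'a set \<Rightarrow> 'a set set \<Rightarrow> 'a \<Rightarrow> 'a \<Rightarrow> 'a set set" where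
  "tree_path V E i j = path_edges (THE p. path_between V E i j p)"

text \<open>
  The vertices \<open>1, \<dots>, n\<close> are in the order in which a depth-first search started at \<open>1\<close> discovers
  them: when \<open>1, \<dots>, k - 1\<close> have been visited, the search goes on from the most recently
  visited vertex that still has an unvisited neighbour, and \<open>k\<close> is such a neighbour of it.
\<close>

definition dfs_numbered :: "nat \<Rightarrow> nat set set \<Rightarrow> bool" where
  "dfs_numbered n E \<longleftrightarrow>
     (\<forall>k\<in>{2..n}. {Max {r \<in> {1..<k}. \<exists>v\<in>{k..n}. {r, v} \<in> E}, k} \<in> E)"

text \<open>
  \<open>E\<close> is the edge set of the tree \<open>\<Gamma>\<close> on \<open>{1..n}\<close>; the rooted tree \<open>\<Gamma>\<^sub>(\<^sub>0\<^sub>)\<close> has the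
  additional root \<open>0\<close> and the additional edge \<open>{0, 1}\<close>. Matrix positions are counted from
  0 in the library, hence the shift by one against the vertex numbers.
\<close>

definition tree_structured_wrt ::
    "nat \<Rightarrow> nat set set \<Rightarrow> (nat set \<Rightarrow> real) \<Rightarrow> real mat \<Rightarrow> bool" where
  "tree_structured_wrt n E w A \<longleftrightarrow>
     A \<in> carrier_mat n n \<and>
     (\<forall>i\<in>{1..n}. \<forall>j\<in>{1..n}. A $$ (i - 1, j - 1) =
        (\<Sum>e \<in> tree_path {0..n} (insert {0, 1} E) i 0 \<inter> tree_path {0..n} (insert {0, 1} E) j 0. w e))"

definition tree_structured :: "nat \<Rightarrow> real mat \<Rightarrow> bool" where
  "tree_structured n A \<longleftrightarrow>
     (\<exists>E w. tree_graph {1..n} E \<and> dfs_numbered n E \<and> tree_structured_wrt n E w A)"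

definition Z_matrix :: "real mat \<Rightarrow> bool" where
  "Z_matrix C \<longleftrightarrow> square_mat C \<and> (\<forall>i<dim_row C. \<forall>j<dim_col C. i \<noteq> j \<longrightarrow> C $$ (i, j) \<le> 0)"

text \<open>\<open>rho q B\<close> is \<open>\<rho>\<^sub>q(B)\<close> for a square matrix \<open>B\<close> and \<open>0 \<le> q \<le> dim_row B + 1\<close>.\<close>

definition rho :: "nat \<Rightarrow> real mat \<Rightarrow> ereal" where
  "rho q B =
     (if q = 0 then - \<infinity>
      else if q > dim_row B then \<infinity>
      else ereal (Max {spectral_radius (map_mat complex_of_real (submatrix B I I)) | I.
                         I \<subseteq> {..<dim_row B} \<and> card I = q}))"

text \<open>\<open>L_class k q\<close> is the class \<open>L\<^sub>q\<close> of \<open>k \<times> k\<close> matrices, for \<open>0 \<le> q \<le> k\<close>.\<close>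

definition L_class :: "nat \<Rightarrow> nat \<Rightarrow> real mat set" where
  "L_class k q = {t \<cdot>\<^sub>m 1\<^sub>m k - B | t B.
     B \<in> carrier_mat k k \<and> 0\<^sub>m k k \<le> B \<and> rho q B \<le> ereal t \<and> ereal t < rho (q + 1) B}"

definition M_matrix :: "nat \<Rightarrow> real mat \<Rightarrow> bool" where
  "M_matrix k C \<longleftrightarrow> C \<in> L_class k k"

definition N0_matrix :: "nat \<Rightarrow> real mat \<Rightarrow> bool" where
  "N0_matrix k C \<longleftrightarrow> 1 \<le> k \<and> C \<in> L_class k (k - 1)"

definition inverse_M_matrix :: "nat \<Rightarrow> real mat \<Rightarrow> bool" where
  "inverse_M_matrix k C \<longleftrightarrow> C \<in> carrier_mat k k \<and> invertible_mat C \<and>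
     (\<exists>D. inverts_mat C D \<and> inverts_mat D C \<and> M_matrix k D)"

definition inverse_N0_matrix :: "nat \<Rightarrow> real mat \<Rightarrow> bool" where
  "inverse_N0_matrix k C \<longleftrightarrow> C \<in> carrier_mat k k \<and> invertible_mat C \<and>
     (\<exists>D. inverts_mat C D \<and> inverts_mat D C \<and> N0_matrix k D)"

definition matrix_graph_edges :: "real mat \<Rightarrow> nat set set" where
  "matrix_graph_edges C = {{i, j} | i j. i \<in> {1..dim_row C} \<and> j \<in> {1..dim_row C} \<and> i \<noteq> j \<and>
     (C $$ (i - 1, j - 1) \<noteq> 0 \<or> C $$ (j - 1, i - 1) \<noteq> 0)}"

definition acyclic_mat :: "real mat \<Rightarrow> bool" where
  "acyclic_mat C \<longleftrightarrow> square_mat C \<and> forest_graph {1..dim_row C} (matrix_graph_edges C)"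

definition permutation_mat :: "nat \<Rightarrow> real mat \<Rightarrow> bool" where
  "permutation_mat n P \<longleftrightarrow>
     (\<exists>p. p permutes {..<n} \<and> P = mat n n (\<lambda>(i, j). if j = p i then 1 else 0))"

text \<open>The all-ones vector \<open>\<xi>\<^sub>k\<close>, as a column, i.e. a \<open>k \<times> 1\<close> matrix.\<close>

definition ones_col :: "nat \<Rightarrow> real mat" where
  "ones_col k = mat k 1 (\<lambda>_. 1)"

definition smallest_entry :: "real mat \<Rightarrow> real" where
  "smallest_entry C = Min (elements_mat C)"

end

theory Submission
  imports Defs "HOL-Analysis.Convex"
begin

text \<open>
  Let \<open>p k\<close> be the parent of vertex \<open>k\<close> in the rooted tree, \<open>\<omega> k\<close> the weight of the edge
  \<open>{p k, k}\<close>, and \<open>U\<close> the 0/1 matrix whose row \<open>i\<close> marks the vertices on the path from \<open>i\<close> to the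
  root (the root excluded). Being of tree structure means \<open>A = U diag(\<omega>) U\<^sup>T\<close>, so the entry at
  \<open>(i, j)\<close> is the length of the common part of two paths to the root. The inverse of \<open>U\<close> takes
  the difference of a function along each edge. Hence, as soon as all weights are nonzero, \<open>A\<close> is
  nonsingular and its inverse \<open>C\<close> is the weighted Laplacian with the quadratic form
  \<open>y\<^sup>T C y = (\<Sum>k. (y k - y (p k))\<^sup>2 / \<omega> k)\<close>, where \<open>y 0 = 0\<close>. The nonzero off-diagonal entries of
  \<open>C\<close> sit on the edges of the tree and equal \<open>- 1 / \<omega> k\<close>; so \<open>C\<close> is acyclic, and it is a
  \<open>Z\<close>-matrix once every weight except possibly \<open>\<omega> 1\<close> is positive.

  Since all matrices here are symmetric, the classes \<open>L\<^sub>q\<close> can be described without eigenvalues: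
  for a nonnegative symmetric \<open>B\<close> the spectral radius is at most \<open>t\<close> if and only if
  \<open>y\<^sup>T B y \<le> t y\<^sup>T y\<close> for all \<open>y\<close>. Thus a symmetric \<open>Z\<close>-matrix is in \<open>L\<^sub>q\<close> if and only if all its
  principal submatrices of order \<open>q\<close> are positive semidefinite and some one of order \<open>q + 1\<close> is not
  (\<open>L_class_iff_psd_on\<close>). Two consequences are read off from this: a symmetric inverse \<open>M\<close>-matrix
  is nonnegative with positive diagonal, and a symmetric inverse \<open>N\<^sub>0\<close>-matrix has a nonpositive
  diagonal.

  Let \<open>S\<close> and \<open>T\<close> be the vertex sets of the two diagonal blocks. The signs of the diagonal entries
  and the constant \<open>\<tau>\<close> off the diagonal blocks force the shape of the tree: \<open>S\<close> contains vertex 1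
  and is closed under parents, \<open>\<omega> 1 = \<tau> < 0\<close>, all other weights are positive, and there is at most
  one edge from \<open>S\<close> to \<open>T\<close>; it starts in vertex 1, and its weight exceeds \<open>- \<tau>\<close>.
  Positivity of a weight inside a block comes from the signs in the inverse of that block
  (\<open>weight_pos_if_block_inverse_Z\<close>).

  Now \<open>C\<close> is in \<open>L\<close> of index \<open>s - 1\<close> by an argument on electrical networks, with \<open>\<omega> k\<close> the resistance
  of an edge. A set \<open>I\<close> of \<open>s - 1\<close> vertices misses some \<open>v \<in> S\<close>. A potential supported on \<open>I\<close> drops
  from \<open>y 1\<close> to 0 along the path from 1 to \<open>v\<close>, whose resistance is \<open>a\<^sub>v\<^sub>v - \<tau> \<le> - \<tau>\<close>; so its energy
  on this path is at least \<open>(y 1)\<^sup>2 / (- \<tau>)\<close>, which outweighs the single negative term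
  \<open>(y 1)\<^sup>2 / \<tau>\<close> (\<open>energy_nonneg_if_resistance_le\<close>). On the other hand, the indicator function of
  \<open>S\<close> has the energy \<open>1 / \<tau>\<close> plus that of the edge from \<open>S\<close> to \<open>T\<close>, which is less than
  \<open>1 / (- \<tau>)\<close>; the sum is negative (\<open>energy_indicator_neg\<close>), so the principal submatrix of order
  \<open>s\<close> on \<open>S\<close> is not positive semidefinite.
\<close>

section \<open>The spectral radius of a symmetric nonnegative matrix\<close>

definition mat_apply :: "real mat \<Rightarrow> (nat \<Rightarrow> real) \<Rightarrow> nat \<Rightarrow> real" where
  "mat_apply B f i = (\<Sum>j<dim_col B. B $$ (i, j) * f j)"

lemma pow_mat_apply:
  assumes B: "B \<in> carrier_mat m m" and i: "i < m"
  shows "(mat_apply B ^^ k) y i = (\<Sum>j<m. (B ^\<^sub>m k) $$ (i, j) * y j)"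
  using i
proof (induction k arbitrary: y)
  case 0
  have "(\<Sum>j<m. (B ^\<^sub>m 0) $$ (i, j) * y j) = (\<Sum>j<m. if j = i then y j else 0)"
    using B 0 by (intro sum.cong) auto
  then show ?case using 0 by simp
next
  case (Suc k)
  have P: "B ^\<^sub>m k \<in> carrier_mat m m" using B by simp
  have "(mat_apply B ^^ Suc k) y i = (\<Sum>l<m. (B ^\<^sub>m k) $$ (i, l) * (\<Sum>j<m. B $$ (l, j) * y j))"
    using Suc.IH[OF Suc.prems, of "mat_apply B y"] B by (simp add: funpow_swap1) (simp add: mat_apply_def)
  also have "\<dots> = (\<Sum>j<m. (\<Sum>l<m. (B ^\<^sub>m k) $$ (i, l) * B $$ (l, j)) * y j)"
    unfolding sum_distrib_left sum_distrib_right
    by (subst sum.swap) (simp add: mult.assoc)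
  also have "\<dots> = (\<Sum>j<m. (B ^\<^sub>m Suc k) $$ (i, j) * y j)"
    using B P Suc.prems by (intro sum.cong)
      (auto simp: scalar_prod_def lessThan_atLeast0)
  finally show ?case .
qed

text \<open>
  By symmetry, the moments \<open>\<mu> k = y\<^sup>T B\<^sup>k y\<close> are inner products \<open>(B\<^sup>a y)\<^sup>T (B\<^sup>b y)\<close> with \<open>a + b = k\<close>, so
  Cauchy-Schwarz gives \<open>(\<mu> k)\<^sup>2 \<le> \<mu> 0 * \<mu> (2 * k)\<close>. If the claim fails, then \<open>\<mu> 1 / \<mu> 0 > 1\<close>, and
  repeated doubling makes the moments unbounded, whereas the powers of a matrix of spectral
  radius below 1 are bounded.
\<close>

lemma quadratic_form_le_if_spectral_radius_less_1:
  fixes B :: "real mat"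
  assumes B: "B \<in> carrier_mat m m"
    and sym: "\<And>i j. i < m \<Longrightarrow> j < m \<Longrightarrow> B $$ (i, j) = B $$ (j, i)"
    and rad: "spectral_radius (map_mat complex_of_real B) < 1"
  shows "(\<Sum>i<m. \<Sum>j<m. B $$ (i, j) * y i * y j) \<le> (\<Sum>i<m. (y i)\<^sup>2)"
proof (rule ccontr)
  assume contra: "\<not> ?thesis"
  define f where "f k = (mat_apply B ^^ k) y" for k
  define \<mu> where "\<mu> k = (\<Sum>i<m. y i * f k i)" for k
  have shift: "(\<Sum>i<m. mat_apply B u i * v i) = (\<Sum>i<m. u i * mat_apply B v i)" for u v
  proof -
    have "(\<Sum>i<m. mat_apply B u i * v i) = (\<Sum>i<m. \<Sum>j<m. B $$ (i, j) * u j * v i)"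
      using B by (simp add: mat_apply_def sum_distrib_right)
    also have "\<dots> = (\<Sum>j<m. \<Sum>i<m. B $$ (j, i) * u j * v i)"
      by (subst sum.swap) (intro sum.cong refl, simp add: sym)
    also have "\<dots> = (\<Sum>i<m. u i * mat_apply B v i)"
      using B by (simp add: mat_apply_def sum_distrib_left ac_simps)
    finally show ?thesis .
  qed
  have moments: "(\<Sum>i<m. f a i * f b i) = \<mu> (a + b)" for a b
  proof (induction a arbitrary: b)
    case 0
    then show ?case by (simp add: f_def \<mu>_def)
  next
    case (Suc a)
    have "(\<Sum>i<m. f (Suc a) i * f b i) = (\<Sum>i<m. f a i * f (Suc b) i)"
      using shift[of "f a" "f b"] by (simp add: f_def)
    then show ?case using Suc.IH[of "Suc b"] by simp
  qed
  have \<mu>0: "\<mu> 0 = (\<Sum>i<m. (y i)\<^sup>2)" by (simp add: \<mu>_def f_def power2_eq_square)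
  have \<mu>1: "\<mu> 1 = (\<Sum>i<m. \<Sum>j<m. B $$ (i, j) * y i * y j)"
    using B by (simp add: \<mu>_def f_def mat_apply_def sum_distrib_left ac_simps)
  have less: "\<mu> 0 < \<mu> 1" using contra \<mu>0 \<mu>1 by simp
  have "\<mu> 0 \<noteq> 0"
  proof
    assume "\<mu> 0 = 0"
    then have "\<forall>i<m. y i = 0" unfolding \<mu>0 by (simp add: sum_nonneg_eq_0_iff)
    then have "\<mu> 1 = 0" by (simp add: \<mu>_def)
    with less \<open>\<mu> 0 = 0\<close> show False by simp
  qed
  moreover have "\<mu> 0 \<ge> 0" unfolding \<mu>0 by (intro sum_nonneg) simp
  ultimately have pos: "\<mu> 0 > 0" by simp
  define r where "r = \<mu> 1 / \<mu> 0"
  have r: "r > 1" using less pos by (simp add: r_def)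
  have growth: "\<mu> 0 * r ^ (2 ^ k) \<le> \<mu> (2 ^ k)" for k
  proof (induction k)
    case 0
    then show ?case using pos by (simp add: r_def)
  next
    case (Suc k)
    have "(\<mu> 0 * r ^ (2 ^ k))\<^sup>2 \<le> (\<mu> (2 ^ k))\<^sup>2"
      using Suc pos r by (intro power_mono) auto
    also have "\<dots> \<le> \<mu> 0 * \<mu> (2 ^ k + 2 ^ k)"
      using Cauchy_Schwarz_ineq_sum[of y "f (2 ^ k)" "{..<m}"]
      by (simp add: \<mu>0 moments[symmetric]) (simp add: \<mu>_def power2_eq_square)
    finally have "\<mu> 0 * (\<mu> 0 * r ^ (2 ^ Suc k)) \<le> \<mu> 0 * \<mu> (2 ^ Suc k)"
      by (simp add: power_mult_distrib power2_eq_square power_add mult_2 ac_simps)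
    then show ?case using pos by simp
  qed
  have carr: "map_mat complex_of_real B \<in> carrier_mat m m" using B by simp
  obtain K where K: "norm_bound (map_mat complex_of_real B ^\<^sub>m k) K" for k
    using spectral_radius_jnf_norm_bound_less_1_upper_triangular[OF carr rad] by blast
  have entry: "\<bar>(B ^\<^sub>m k) $$ (i, j)\<bar> \<le> K" if "i < m" "j < m" for k i j
  proof -
    have "map_mat complex_of_real B ^\<^sub>m k = map_mat complex_of_real (B ^\<^sub>m k)"
      by (rule of_real_hom.mat_hom_pow[OF B, symmetric])
    then show ?thesis using K[of k] that B unfolding norm_bound_def by auto
  qed
  define K' where "K' = (\<Sum>i<m. \<Sum>j<m. \<bar>y i\<bar> * (K * \<bar>y j\<bar>))"
  have bound: "\<mu> k \<le> K'" for k
  proof -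
    have "\<mu> k = (\<Sum>i<m. \<Sum>j<m. y i * ((B ^\<^sub>m k) $$ (i, j) * y j))"
      unfolding \<mu>_def f_def by (intro sum.cong) (auto simp: pow_mat_apply[OF B] sum_distrib_left)
    also have "\<dots> \<le> K'"
      unfolding K'_def
    proof (intro sum_mono)
      fix i j assume "i \<in> {..<m}" "j \<in> {..<m}"
      then have "\<bar>y i * ((B ^\<^sub>m k) $$ (i, j) * y j)\<bar> \<le> \<bar>y i\<bar> * (K * \<bar>y j\<bar>)"
        using entry[of i j k] by (simp add: abs_mult mult_left_mono mult_right_mono)
      then show "y i * ((B ^\<^sub>m k) $$ (i, j) * y j) \<le> \<bar>y i\<bar> * (K * \<bar>y j\<bar>)" by linarith
    qed
    finally show ?thesis .
  qed
  obtain N where N: "K' / \<mu> 0 < r ^ N" using real_arch_pow[OF r] by blast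
  have "r ^ N \<le> r ^ (2 ^ N)" using r by (intro power_increasing) auto
  then have "K' < \<mu> 0 * r ^ (2 ^ N)" using N pos by (simp add: field_simps) (smt (verit) mult_left_mono)
  with growth[of N] bound[of "2 ^ N"] show False by linarith
qed

lemma spectrum_smult:
  fixes M :: "complex mat"
  assumes M: "M \<in> carrier_mat m m" and c: "c \<noteq> 0" and ev: "ev \<in> spectrum (c \<cdot>\<^sub>m M)"
  shows "ev / c \<in> spectrum M"
proof -
  obtain v where v: "v \<in> carrier_vec m" "v \<noteq> 0\<^sub>v m" "(c \<cdot>\<^sub>m M) *\<^sub>v v = ev \<cdot>\<^sub>v v"
    using ev M unfolding spectrum_def eigenvalue_def eigenvector_def by auto
  have eq: "c \<cdot>\<^sub>v (M *\<^sub>v v) = ev \<cdot>\<^sub>v v"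
    unfolding v(3)[symmetric] using v(1) M
    by (intro eq_vecI) (auto simp: scalar_prod_def sum_distrib_left mult.assoc)
  have "M *\<^sub>v v = (1 / c) \<cdot>\<^sub>v (c \<cdot>\<^sub>v (M *\<^sub>v v))"
    using c by (simp add: smult_smult_assoc)
  also have "\<dots> = (ev / c) \<cdot>\<^sub>v v"
    unfolding eq by (simp add: smult_smult_assoc)
  finally have "eigenvector M v (ev / c)" using v M unfolding eigenvector_def by auto
  then show ?thesis unfolding spectrum_def eigenvalue_def by auto
qed

text \<open>
  Scaling by \<open>1 / c\<close> for each \<open>c > t\<close> reduces this to the previous bound, and \<open>c\<close> then tends to \<open>t\<close>.
\<close>

lemma quadratic_form_le_if_spectral_radius_le:
  fixes B :: "real mat"
  assumes B: "B \<in> carrier_mat m m" and m: "0 < m"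
    and sym: "\<And>i j. i < m \<Longrightarrow> j < m \<Longrightarrow> B $$ (i, j) = B $$ (j, i)"
    and rad: "spectral_radius (map_mat complex_of_real B) \<le> t"
  shows "(\<Sum>i<m. \<Sum>j<m. B $$ (i, j) * y i * y j) \<le> t * (\<Sum>i<m. (y i)\<^sup>2)"
proof -
  let ?M = "map_mat complex_of_real B"
  let ?n = "\<Sum>i<m. (y i)\<^sup>2"
  have M: "?M \<in> carrier_mat m m" using B by simp
  have t: "0 \<le> t" using spectral_radius_mem_max(1)[OF M m] rad by (auto intro: order_trans[OF norm_ge_zero])
  have *: "(\<Sum>i<m. \<Sum>j<m. B $$ (i, j) * y i * y j) \<le> c * ?n" if c: "c > t" for c
  proof -
    let ?B = "(1 / c) \<cdot>\<^sub>m B"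
    have c0: "c > 0" using c t by simp
    have hom: "map_mat complex_of_real ?B = complex_of_real (1 / c) \<cdot>\<^sub>m ?M"
      by (rule eq_matI) auto
    have "spectral_radius (map_mat complex_of_real ?B) < 1"
    proof -
      have carr: "map_mat complex_of_real ?B \<in> carrier_mat m m" using B by simp
      obtain ev where ev: "ev \<in> spectrum (map_mat complex_of_real ?B)"
        "spectral_radius (map_mat complex_of_real ?B) = norm ev"
        using spectral_radius_mem_max(1)[OF carr m] by auto
      have "ev / complex_of_real (1 / c) \<in> spectrum ?M"
        using spectrum_smult[OF M, of "complex_of_real (1 / c)" ev] ev(1) c0 unfolding hom by simp
      then have "norm (ev / complex_of_real (1 / c)) \<le> t"
        using spectral_radius_mem_max(2)[OF M m] rad by fastforce
      then have "norm ev * c \<le> t" using c0 by (simp add: norm_mult)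
      then have "norm ev * c < 1 * c" using c by simp
      then have "norm ev < 1" using c0 by (simp only: mult_less_cancel_right_pos)
      then show ?thesis using ev(2) by simp
    qed
    then have "(\<Sum>i<m. \<Sum>j<m. ?B $$ (i, j) * y i * y j) \<le> ?n"
      using B sym by (intro quadratic_form_le_if_spectral_radius_less_1) auto
    then have "c * (\<Sum>i<m. \<Sum>j<m. ?B $$ (i, j) * y i * y j) \<le> c * ?n"
      using c0 by (intro mult_left_mono) auto
    moreover have "c * (\<Sum>i<m. \<Sum>j<m. ?B $$ (i, j) * y i * y j) = (\<Sum>i<m. \<Sum>j<m. B $$ (i, j) * y i * y j)"
      unfolding sum_distrib_left using B c0 by (intro sum.cong) auto
    ultimately show ?thesis by simp
  qed
  have n0: "0 \<le> ?n" by (intro sum_nonneg) simp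
  show ?thesis
  proof (rule field_le_epsilon)
    fix e :: real assume e: "e > 0"
    have "(\<Sum>i<m. \<Sum>j<m. B $$ (i, j) * y i * y j) \<le> (t + e / (?n + 1)) * ?n"
      using e n0 by (intro *) simp
    also have "\<dots> \<le> t * ?n + e"
      using e n0 by (simp add: field_simps)
    finally show "(\<Sum>i<m. \<Sum>j<m. B $$ (i, j) * y i * y j) \<le> t * ?n + e" .
  qed
qed

text \<open>
  For an eigenvector \<open>v\<close> of a complex eigenvalue \<open>ev\<close>, the entrywise absolute value \<open>y\<close> of \<open>v\<close> satisfies
  \<open>\<bar>ev\<bar> y \<le> B y\<close> because \<open>B\<close> is nonnegative; the inner product with \<open>y\<close> gives the bound.
\<close>

lemma spectral_radius_le_if_quadratic_form_le:
  fixes B :: "real mat"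
  assumes B: "B \<in> carrier_mat m m" and m: "0 < m"
    and nonneg: "\<And>i j. i < m \<Longrightarrow> j < m \<Longrightarrow> 0 \<le> B $$ (i, j)"
    and form: "\<And>y. (\<Sum>i<m. \<Sum>j<m. B $$ (i, j) * y i * y j) \<le> t * (\<Sum>i<m. (y i)\<^sup>2)"
  shows "spectral_radius (map_mat complex_of_real B) \<le> t"
proof -
  let ?M = "map_mat complex_of_real B"
  have M: "?M \<in> carrier_mat m m" using B by simp
  obtain ev where ev: "ev \<in> spectrum ?M" "spectral_radius ?M = norm ev"
    using spectral_radius_mem_max(1)[OF M m] by auto
  obtain v where v: "v \<in> carrier_vec m" "v \<noteq> 0\<^sub>v m" "?M *\<^sub>v v = ev \<cdot>\<^sub>v v"
    using ev(1) M unfolding spectrum_def eigenvalue_def eigenvector_def by auto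
  define y where "y i = norm (v $ i)" for i
  have row: "norm ev * y i \<le> (\<Sum>j<m. B $$ (i, j) * y j)" if i: "i < m" for i
  proof -
    have "ev * v $ i = (ev \<cdot>\<^sub>v v) $ i" using i v by simp
    also have "\<dots> = (\<Sum>j<m. complex_of_real (B $$ (i, j)) * v $ j)"
      using i v(1) B unfolding v(3)[symmetric] by (auto simp: scalar_prod_def lessThan_atLeast0)
    finally have "norm ev * y i = norm (\<Sum>j<m. complex_of_real (B $$ (i, j)) * v $ j)"
      by (simp add: y_def flip: norm_mult)
    also have "\<dots> \<le> (\<Sum>j<m. norm (complex_of_real (B $$ (i, j)) * v $ j))"
      by (rule norm_sum)
    also have "\<dots> = (\<Sum>j<m. B $$ (i, j) * y j)"
      using nonneg i by (intro sum.cong) (auto simp: norm_mult y_def)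
    finally show ?thesis .
  qed
  obtain l where l: "l < m" "v $ l \<noteq> 0" using v(1,2) by (metis carrier_vecD eq_vecI index_zero_vec)
  have pos: "0 < (\<Sum>i<m. (y i)\<^sup>2)"
    using l by (intro sum_pos2[of _ l]) (auto simp: y_def)
  have "norm ev * (\<Sum>i<m. (y i)\<^sup>2) = (\<Sum>i<m. y i * (norm ev * y i))"
    by (simp add: sum_distrib_left power2_eq_square ac_simps)
  also have "\<dots> \<le> (\<Sum>i<m. y i * (\<Sum>j<m. B $$ (i, j) * y j))"
    using row by (intro sum_mono mult_left_mono) (auto simp: y_def)
  also have "\<dots> = (\<Sum>i<m. \<Sum>j<m. B $$ (i, j) * y i * y j)"
    by (simp add: sum_distrib_left ac_simps)
  also have "\<dots> \<le> t * (\<Sum>i<m. (y i)\<^sup>2)" by (rule form)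
  finally show ?thesis using pos ev(2) by simp
qed

section \<open>The classes \<open>L\<^sub>q\<close> for symmetric matrices\<close>

text \<open>
  Positive semidefiniteness of the principal submatrix on the index set \<open>I\<close>. The entries are kept at
  their positions in \<open>C\<close>, which avoids the renumbering of rows and columns in submatrices.
\<close>

definition psd_on :: "nat set \<Rightarrow> real mat \<Rightarrow> bool" where
  "psd_on I C \<longleftrightarrow> (\<forall>y. 0 \<le> (\<Sum>i\<in>I. \<Sum>j\<in>I. C $$ (i, j) * y i * y j))"

definition symmetric_on :: "nat \<Rightarrow> real mat \<Rightarrow> bool" where
  "symmetric_on k C \<longleftrightarrow> (\<forall>i<k. \<forall>j<k. C $$ (i, j) = C $$ (j, i))"

lemma bij_betw_pick:
  assumes "finite I"
  shows "bij_betw (pick I) {..<card I} I"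
proof -
  have inj: "inj_on (pick I) {..<card I}"
  proof (rule inj_onI)
    fix a b assume "a \<in> {..<card I}" "b \<in> {..<card I}" "pick I a = pick I b"
    then show "a = b" using pick_mono[of a I b] pick_mono[of b I a] by (cases a b rule: linorder_cases) auto
  qed
  moreover have "pick I ` {..<card I} \<subseteq> I" using pick_in_set by auto
  ultimately have "pick I ` {..<card I} = I"
    using assms by (intro card_subset_eq) (auto simp: card_image)
  with inj show ?thesis by (simp add: bij_betw_def)
qed

lemma spectral_radius_submatrix_le_iff:
  fixes B :: "real mat"
  assumes B: "B \<in> carrier_mat k k" and sym: "symmetric_on k B" and nonneg: "0\<^sub>m k k \<le> B"
    and I: "I \<subseteq> {..<k}" "I \<noteq> {}"
  shows "spectral_radius (map_mat complex_of_real (submatrix B I I)) \<le> t \<longleftrightarrow>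
    (\<forall>y. (\<Sum>i\<in>I. \<Sum>j\<in>I. B $$ (i, j) * y i * y j) \<le> t * (\<Sum>i\<in>I. (y i)\<^sup>2))"
proof -
  let ?m = "card I" and ?S = "submatrix B I I"
  have fin: "finite I" using I(1) finite_subset by blast
  then have m: "0 < ?m" using I(2) by (simp add: card_gt_0_iff)
  note bij = bij_betw_pick[OF fin]
  have dims: "card {i. i < dim_row B \<and> i \<in> I} = ?m" "card {i. i < dim_col B \<and> i \<in> I} = ?m"
    using I(1) B by (auto intro!: arg_cong[of _ _ card])
  have carr: "?S \<in> carrier_mat ?m ?m"
    by (rule carrier_matI) (simp_all only: dim_submatrix dims)
  have idx: "?S $$ (a, b) = B $$ (pick I a, pick I b)" if "a < ?m" "b < ?m" for a b
    using that by (intro submatrix_index) (simp_all only: dims)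
  have pick: "pick I a < k" if "a < ?m" for a
    using bij_betwE[OF bij] that I(1) by auto
  have form: "(\<Sum>a<?m. \<Sum>b<?m. ?S $$ (a, b) * y (pick I a) * y (pick I b)) =
      (\<Sum>i\<in>I. \<Sum>j\<in>I. B $$ (i, j) * y i * y j)" for y
  proof -
    have "(\<Sum>a<?m. \<Sum>b<?m. ?S $$ (a, b) * y (pick I a) * y (pick I b)) =
        (\<Sum>a<?m. \<Sum>b<?m. B $$ (pick I a, pick I b) * y (pick I a) * y (pick I b))"
      by (intro sum.cong refl) (simp add: idx)
    also have "\<dots> = (\<Sum>a<?m. \<Sum>j\<in>I. B $$ (pick I a, j) * y (pick I a) * y j)"
      by (intro sum.cong refl sum.reindex_bij_betw[OF bij])
    also have "\<dots> = (\<Sum>i\<in>I. \<Sum>j\<in>I. B $$ (i, j) * y i * y j)"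
      by (rule sum.reindex_bij_betw[OF bij])
    finally show ?thesis .
  qed
  have sq: "(\<Sum>a<?m. (y (pick I a))\<^sup>2) = (\<Sum>i\<in>I. (y i)\<^sup>2)" for y :: "nat \<Rightarrow> real"
    by (rule sum.reindex_bij_betw[OF bij])
  show ?thesis
  proof
    assume "spectral_radius (map_mat complex_of_real ?S) \<le> t"
    then have "(\<Sum>a<?m. \<Sum>b<?m. ?S $$ (a, b) * z a * z b) \<le> t * (\<Sum>a<?m. (z a)\<^sup>2)" for z
      using sym pick by (intro quadratic_form_le_if_spectral_radius_le carr m)
        (auto simp: idx symmetric_on_def)
    then have "(\<Sum>i\<in>I. \<Sum>j\<in>I. B $$ (i, j) * y i * y j) \<le> t * (\<Sum>i\<in>I. (y i)\<^sup>2)" for y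
      unfolding form[of y, symmetric] sq[of y, symmetric] .
    then show "\<forall>y. (\<Sum>i\<in>I. \<Sum>j\<in>I. B $$ (i, j) * y i * y j) \<le> t * (\<Sum>i\<in>I. (y i)\<^sup>2)" by blast
  next
    assume *: "\<forall>y. (\<Sum>i\<in>I. \<Sum>j\<in>I. B $$ (i, j) * y i * y j) \<le> t * (\<Sum>i\<in>I. (y i)\<^sup>2)"
    show "spectral_radius (map_mat complex_of_real ?S) \<le> t"
    proof (rule spectral_radius_le_if_quadratic_form_le[OF carr m])
      fix a b assume "a < ?m" "b < ?m"
      then show "0 \<le> ?S $$ (a, b)"
        using nonneg pick B by (auto simp: idx less_eq_mat_def)
    next
      fix z :: "nat \<Rightarrow> real"
      define y where "y i = z (the_inv_into {..<?m} (pick I) i)" for i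
      have y: "y (pick I a) = z a" if "a < ?m" for a
        using that bij by (simp add: y_def the_inv_into_f_f bij_betw_def)
      show "(\<Sum>a<?m. \<Sum>b<?m. ?S $$ (a, b) * z a * z b) \<le> t * (\<Sum>a<?m. (z a)\<^sup>2)"
        using *[rule_format, of y] unfolding form[of y, symmetric] sq[of y, symmetric] by (simp add: y)
    qed
  qed
qed

text \<open>
  The eigenvalue condition in the definition of \<open>L\<^sub>q\<close> becomes a condition on quadratic forms. It also
  holds for \<open>q = 0\<close>, where both sides are trivially true.
\<close>

lemma rho_le_iff_psd_on:
  fixes B C :: "real mat"
  assumes B: "B \<in> carrier_mat k k" and sym: "symmetric_on k B" and nonneg: "0\<^sub>m k k \<le> B"
    and C: "C = t \<cdot>\<^sub>m 1\<^sub>m k - B" and q: "q \<le> k"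
  shows "rho q B \<le> ereal t \<longleftrightarrow> (\<forall>I\<subseteq>{..<k}. card I = q \<longrightarrow> psd_on I C)"
proof (cases "q = 0")
  case True
  have "psd_on I C" if "I \<subseteq> {..<k}" "card I = 0" for I
  proof -
    have "I = {}" using that finite_subset[OF that(1)] by simp
    then show ?thesis by (simp add: psd_on_def)
  qed
  then show ?thesis using True by (simp add: rho_def)
next
  case False
  let ?R = "{spectral_radius (map_mat complex_of_real (submatrix B I I)) | I.
                         I \<subseteq> {..<dim_row B} \<and> card I = q}"
  have "finite {I. I \<subseteq> {..<k} \<and> card I = q}" by (rule finite_subset[of _ "Pow {..<k}"]) auto
  moreover have R: "?R = (\<lambda>I. spectral_radius (map_mat complex_of_real (submatrix B I I))) `
      {I. I \<subseteq> {..<k} \<and> card I = q}"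
    using B by auto
  ultimately have "finite ?R" by simp
  moreover have "?R \<noteq> {}"
    unfolding R using q by (auto intro!: exI[of _ "{..<q}"])
  ultimately have "rho q B \<le> ereal t \<longleftrightarrow> (\<forall>I\<subseteq>{..<k}. card I = q \<longrightarrow>
      spectral_radius (map_mat complex_of_real (submatrix B I I)) \<le> t)"
    using False q B by (auto simp: rho_def)
  also have "\<dots> \<longleftrightarrow> (\<forall>I\<subseteq>{..<k}. card I = q \<longrightarrow> psd_on I C)"
  proof (intro all_cong imp_cong refl)
    fix I assume I: "I \<subseteq> {..<k}" and cI: "card I = q"
    have ne: "I \<noteq> {}" using cI False by auto
    have fin: "finite I" using I finite_subset by blast
    have "(\<Sum>i\<in>I. \<Sum>j\<in>I. C $$ (i, j) * y i * y j) =
        t * (\<Sum>i\<in>I. (y i)\<^sup>2) - (\<Sum>i\<in>I. \<Sum>j\<in>I. B $$ (i, j) * y i * y j)" for y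
    proof -
      have "(\<Sum>j\<in>I. C $$ (i, j) * y i * y j) = t * (y i)\<^sup>2 - (\<Sum>j\<in>I. B $$ (i, j) * y i * y j)"
        if i: "i \<in> I" for i
      proof -
        have "(\<Sum>j\<in>I. C $$ (i, j) * y i * y j) =
            (\<Sum>j\<in>I. (if i = j then t * y i * y j else 0) - B $$ (i, j) * y i * y j)"
          using i I B unfolding C by (intro sum.cong) (auto simp: subset_iff algebra_simps)
        also have "\<dots> = t * y i * y i - (\<Sum>j\<in>I. B $$ (i, j) * y i * y j)"
          using fin i by (simp add: sum_subtractf)
        finally show ?thesis by (simp add: power2_eq_square)
      qed
      then show ?thesis by (simp add: sum_subtractf sum_distrib_left)
    qed
    then show "spectral_radius (map_mat complex_of_real (submatrix B I I)) \<le> t \<longleftrightarrow> psd_on I C"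
      unfolding spectral_radius_submatrix_le_iff[OF B sym nonneg I ne] psd_on_def by simp
  qed
  finally show ?thesis .
qed

lemma off_diagonal_nonpos_if_L_class:
  assumes "C \<in> L_class k q" and "i < k" "j < k" "i \<noteq> j"
  shows "C $$ (i, j) \<le> 0"
proof -
  obtain t B where B: "C = t \<cdot>\<^sub>m 1\<^sub>m k - B" "B \<in> carrier_mat k k" "0\<^sub>m k k \<le> B"
    using assms(1) unfolding L_class_def by blast
  then have "0 \<le> B $$ (i, j)" using assms(2,3) unfolding less_eq_mat_def by auto
  then show ?thesis using B(1,2) assms by simp
qed

text \<open>
  The decomposition \<open>C = t I - B\<close> is not unique, but the right-hand side does not mention it: it is
  equivalent to the spectral condition for each decomposition, so any \<open>t\<close> that makes \<open>B\<close> nonnegative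
  can be used for the converse direction.
\<close>

lemma L_class_iff_psd_on:
  assumes C: "C \<in> carrier_mat k k" and sym: "symmetric_on k C"
    and Z: "\<And>i j. i < k \<Longrightarrow> j < k \<Longrightarrow> i \<noteq> j \<Longrightarrow> C $$ (i, j) \<le> 0" and q: "q \<le> k"
  shows "C \<in> L_class k q \<longleftrightarrow>
    (\<forall>I\<subseteq>{..<k}. card I = q \<longrightarrow> psd_on I C) \<and>
    (q < k \<longrightarrow> (\<exists>I\<subseteq>{..<k}. card I = q + 1 \<and> \<not> psd_on I C))"
    (is "_ \<longleftrightarrow> ?psd")
proof -
  have iff: "rho q B \<le> ereal t \<and> ereal t < rho (q + 1) B \<longleftrightarrow> ?psd"
    if B: "B \<in> carrier_mat k k" "0\<^sub>m k k \<le> B" and CB: "C = t \<cdot>\<^sub>m 1\<^sub>m k - B" for t B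
  proof -
    have symB: "symmetric_on k B"
      unfolding symmetric_on_def
    proof (intro allI impI)
      fix i j assume ij: "i < k" "j < k"
      then show "B $$ (i, j) = B $$ (j, i)"
        using sym[unfolded symmetric_on_def, rule_format, of i j] B unfolding CB by (cases "i = j") auto
    qed
    show ?thesis
    proof (cases "q < k")
      case True
      then have "rho (q + 1) B \<le> ereal t \<longleftrightarrow> (\<forall>I\<subseteq>{..<k}. card I = q + 1 \<longrightarrow> psd_on I C)"
        by (intro rho_le_iff_psd_on[OF B(1) symB B(2) CB]) simp
      then have "\<not> rho (q + 1) B \<le> ereal t \<longleftrightarrow> (\<exists>I\<subseteq>{..<k}. card I = q + 1 \<and> \<not> psd_on I C)"
        by blast
      then have "ereal t < rho (q + 1) B \<longleftrightarrow> (\<exists>I\<subseteq>{..<k}. card I = q + 1 \<and> \<not> psd_on I C)"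
        by (simp only: not_le)
      then show ?thesis
        using rho_le_iff_psd_on[OF B(1) symB B(2) CB q] True by simp
    next
      case False
      then show ?thesis
        using rho_le_iff_psd_on[OF B(1) symB B(2) CB q] B q by (auto simp: rho_def)
    qed
  qed
  show ?thesis
  proof
    assume "C \<in> L_class k q"
    then show ?psd unfolding L_class_def using iff by blast
  next
    assume psd: ?psd
    define t where "t = (\<Sum>i<k. \<bar>C $$ (i, i)\<bar>)"
    define B where "B = t \<cdot>\<^sub>m 1\<^sub>m k - C"
    have B: "B \<in> carrier_mat k k" using C by (auto simp: B_def)
    have CB: "C = t \<cdot>\<^sub>m 1\<^sub>m k - B" using C by (intro eq_matI) (auto simp: B_def)
    have "C $$ (i, i) \<le> t" if "i < k" for i
    proof -
      have "\<bar>C $$ (i, i)\<bar> \<le> t" unfolding t_def using that by (intro member_le_sum) auto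
      then show ?thesis by linarith
    qed
    then have nonneg: "0\<^sub>m k k \<le> B"
      using C Z by (auto simp: less_eq_mat_def B_def)
    show "C \<in> L_class k q"
      unfolding L_class_def using CB B nonneg iff[OF B nonneg CB] psd by blast
  qed
qed

section \<open>Symmetric inverse \<open>M\<close>-matrices and inverse \<open>N\<^sub>0\<close>-matrices\<close>

definition bilin :: "nat set \<Rightarrow> real mat \<Rightarrow> (nat \<Rightarrow> real) \<Rightarrow> (nat \<Rightarrow> real) \<Rightarrow> real" where
  "bilin I C u v = (\<Sum>i\<in>I. \<Sum>j\<in>I. C $$ (i, j) * u i * v j)"

lemma bilin_altdef: "bilin I C u v = (\<Sum>i\<in>I. u i * (\<Sum>j\<in>I. C $$ (i, j) * v j))"
  by (simp add: bilin_def sum_distrib_left ac_simps)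

lemma bilin_commute:
  assumes "symmetric_on m C"
  shows "bilin {..<m} C u v = bilin {..<m} C v u"
proof -
  have "bilin {..<m} C u v = (\<Sum>j<m. \<Sum>i<m. C $$ (i, j) * u i * v j)"
    unfolding bilin_def by (rule sum.swap)
  also have "\<dots> = bilin {..<m} C v u"
    unfolding bilin_def using assms by (intro sum.cong refl) (auto simp: symmetric_on_def)
  finally show ?thesis .
qed

lemma bilin_add_scaled:
  assumes "symmetric_on m C"
  shows "bilin {..<m} C (\<lambda>i. u i + c * v i) (\<lambda>i. u i + c * v i) =
    bilin {..<m} C u u + 2 * c * bilin {..<m} C u v + c\<^sup>2 * bilin {..<m} C v v"
proof -
  have "bilin {..<m} C (\<lambda>i. u i + c * v i) (\<lambda>i. u i + c * v i) =
    bilin {..<m} C u u + c * bilin {..<m} C u v + c * bilin {..<m} C v u + c\<^sup>2 * bilin {..<m} C v v"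
    unfolding bilin_def sum_distrib_left sum.distrib[symmetric]
    by (intro sum.cong refl) (simp add: algebra_simps power2_eq_square)
  then show ?thesis using bilin_commute[OF assms, of v u] by simp
qed

text \<open>
  With \<open>w = D z\<close>, the form at \<open>z + c w\<close> equals \<open>2 c w\<^sup>T w + c\<^sup>2 w\<^sup>T D w\<close>, which is negative for small
  negative \<open>c\<close> unless \<open>w = 0\<close>.
\<close>

lemma psd_null_vector:
  assumes sym: "symmetric_on m D" and psd: "psd_on {..<m} D" and zero: "bilin {..<m} D z z = 0"
    and i: "i < m"
  shows "(\<Sum>j<m. D $$ (i, j) * z j) = 0"
proof (rule ccontr)
  define w where "w i = (\<Sum>j<m. D $$ (i, j) * z j)" for i
  let ?a = "bilin {..<m} D w w" and ?b = "\<Sum>i<m. (w i)\<^sup>2"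
  assume "(\<Sum>j<m. D $$ (i, j) * z j) \<noteq> 0"
  then have b: "?b > 0" using i by (intro sum_pos2[of _ i]) (auto simp: w_def)
  have "bilin {..<m} D z w = bilin {..<m} D w z" by (rule bilin_commute[OF sym])
  also have "\<dots> = ?b" unfolding bilin_altdef w_def[symmetric] by (simp add: power2_eq_square)
  finally have "bilin {..<m} D z w = ?b" .
  then have *: "0 \<le> 2 * c * ?b + c\<^sup>2 * ?a" for c :: real
  proof -
    have "0 \<le> bilin {..<m} D (\<lambda>i. z i + c * w i) (\<lambda>i. z i + c * w i)"
      using psd unfolding psd_on_def bilin_def by (rule spec)
    then show ?thesis using \<open>bilin {..<m} D z w = ?b\<close> zero by (simp add: bilin_add_scaled[OF sym])
  qed
  \<comment> \<open>This choice makes \<open>c\<close> negative with \<open>\<bar>c * ?a\<bar> \<le> ?b\<close>, so the linear term dominates.\<close>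
  define c where "c = - ?b / (\<bar>?a\<bar> + ?b)"
  have pos: "\<bar>?a\<bar> + ?b > 0" using b by linarith
  have c: "c < 0" using b pos by (simp add: c_def)
  have "- c * ?a \<le> - c * (\<bar>?a\<bar> + ?b)" using c b by (intro mult_left_mono) auto
  also have "\<dots> = ?b" using pos by (simp add: c_def)
  finally have "2 * ?b + c * ?a > 0" using b by linarith
  then have "c * (2 * ?b + c * ?a) < 0" using c by (simp add: mult_neg_pos)
  with *[of c] show False by (simp add: algebra_simps power2_eq_square)
qed

lemma inverse_pair_sums:
  fixes A D :: "real mat"
  assumes "A \<in> carrier_mat m m" "D \<in> carrier_mat m m" "A * D = 1\<^sub>m m" "i < m" "l < m"
  shows "(\<Sum>j<m. A $$ (i, j) * D $$ (j, l)) = (if i = l then 1 else 0)"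
proof -
  have "(A * D) $$ (i, l) = (\<Sum>j<m. A $$ (i, j) * D $$ (j, l))"
    using assms(1,2,4,5) by (auto simp: scalar_prod_def lessThan_atLeast0)
  then show ?thesis using assms by simp
qed

lemma symmetric_inverse:
  fixes A D :: "real mat"
  assumes A: "A \<in> carrier_mat m m" and D: "D \<in> carrier_mat m m"
    and AD: "A * D = 1\<^sub>m m" and sym: "symmetric_on m A"
  shows "symmetric_on m D"
proof -
  have At: "transpose_mat A = A" using A sym by (intro eq_matI) (auto simp: symmetric_on_def)
  have Dt: "transpose_mat D \<in> carrier_mat m m" using D by simp
  have "transpose_mat D * A = transpose_mat (A * D)"
    using transpose_mult[OF A D] At by simp
  then have DtA: "transpose_mat D * A = 1\<^sub>m m" using AD by simp
  have "transpose_mat D = transpose_mat D * (A * D)" using Dt AD by simp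
  also have "\<dots> = D" using DtA A D Dt by (simp flip: assoc_mult_mat)
  finally have Deq: "transpose_mat D = D" .
  have "D $$ (i, j) = D $$ (j, i)" if "i < m" "j < m" for i j
    using that D arg_cong[OF Deq, of "\<lambda>M. M $$ (i, j)"] by simp
  then show ?thesis by (simp add: symmetric_on_def)
qed

text \<open>
  The form pairs a vector with a column of the inverse by evaluating the vector, because \<open>D\<close> maps that
  column to a unit vector.
\<close>

lemma inverse_column_value:
  fixes A D :: "real mat"
  assumes "A \<in> carrier_mat m m" "D \<in> carrier_mat m m" "D * A = 1\<^sub>m m" "v < m"
  shows "bilin {..<m} D u (\<lambda>j. A $$ (j, v)) = u v"
proof -
  have "bilin {..<m} D u (\<lambda>j. A $$ (j, v)) = (\<Sum>i<m. if i = v then u i else 0)"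
    unfolding bilin_altdef using assms
    by (intro sum.cong refl) (simp add: inverse_pair_sums[OF assms(2,1,3)])
  then show ?thesis using assms(4) by simp
qed

text \<open>
  Let \<open>x\<close> be a column of \<open>A\<close> and \<open>y\<close> its negative part. As \<open>x + y\<close> and \<open>y\<close> have disjoint supports and
  the off-diagonal entries of \<open>D\<close> are nonpositive, \<open>y\<^sup>T D y \<le> - y\<^sup>T D x \<le> 0\<close>. A nonsingular positive
  semidefinite \<open>D\<close> is definite, so \<open>y = 0\<close>. The diagonal entry is \<open>x\<^sup>T D x\<close>, hence positive.
\<close>

lemma inverse_nonneg_if_psd_Z:
  fixes A D :: "real mat"
  assumes A: "A \<in> carrier_mat m m" and D: "D \<in> carrier_mat m m"
    and AD: "A * D = 1\<^sub>m m" and DA: "D * A = 1\<^sub>m m" and sym: "symmetric_on m D"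
    and Z: "\<And>i j. i < m \<Longrightarrow> j < m \<Longrightarrow> i \<noteq> j \<Longrightarrow> D $$ (i, j) \<le> 0"
    and psd: "psd_on {..<m} D" and l: "l < m" and i: "i < m"
  shows "0 \<le> A $$ (i, l)" and "0 < A $$ (l, l)"
proof -
  have null: "z i = 0" if z: "bilin {..<m} D z z = 0" and i: "i < m" for z i
  proof -
    have "z i = (\<Sum>k<m. (\<Sum>j<m. A $$ (i, j) * D $$ (j, k)) * z k)"
    proof -
      have "(\<Sum>k<m. (\<Sum>j<m. A $$ (i, j) * D $$ (j, k)) * z k) = (\<Sum>k<m. if i = k then z k else 0)"
        using i by (intro sum.cong refl) (simp add: inverse_pair_sums[OF A D AD])
      then show ?thesis using i by simp
    qed
    also have "\<dots> = (\<Sum>j<m. A $$ (i, j) * (\<Sum>k<m. D $$ (j, k) * z k))"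
      unfolding sum_distrib_left sum_distrib_right by (subst sum.swap) (simp add: ac_simps)
    also have "\<dots> = 0"
      using psd_null_vector[OF sym psd z] by simp
    finally show ?thesis .
  qed
  define x where "x j = A $$ (j, l)" for j
  define y where "y j = max 0 (- x j)" for j
  have "bilin {..<m} D y y \<le> - bilin {..<m} D y x"
    unfolding bilin_def sum_negf[symmetric]
  proof (intro sum_mono)
    fix i j assume ij: "i \<in> {..<m}" "j \<in> {..<m}"
    have "D $$ (i, j) * (y i * (y j + x j)) \<le> 0"
    proof (cases "i = j")
      case True
      then have "y i * (y j + x j) = 0" by (auto simp: y_def max_def)
      then show ?thesis by (simp only: mult_zero_right order_refl)
    next
      case False
      have "0 \<le> y i * (y j + x j)" by (intro mult_nonneg_nonneg) (auto simp: y_def)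
      then show ?thesis using Z[of i j] ij False by (simp add: mult_nonpos_nonneg)
    qed
    then show "D $$ (i, j) * y i * y j \<le> - (D $$ (i, j) * y i * x j)"
      by (simp add: algebra_simps)
  qed
  also have "\<dots> \<le> 0"
    unfolding x_def inverse_column_value[OF A D DA l] by (simp add: y_def)
  finally have "bilin {..<m} D y y = 0"
    using psd[unfolded psd_on_def, rule_format, of y] by (simp add: bilin_def)
  then have y0: "y j = 0" if "j < m" for j using null that by blast
  show "0 \<le> A $$ (i, l)" using y0[OF i] by (simp add: y_def x_def max_def split: if_splits)
  have nonneg: "0 \<le> A $$ (l, l)" using y0[OF l] by (simp add: y_def x_def max_def split: if_splits)
  have "A $$ (l, l) \<noteq> 0"
  proof
    assume "A $$ (l, l) = 0"
    then have "bilin {..<m} D x x = 0"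
      unfolding x_def inverse_column_value[OF A D DA l] .
    then have "(\<Sum>j<m. D $$ (l, j) * x j) = 0"
      using psd_null_vector[OF sym psd] l by blast
    then show False using inverse_pair_sums[OF D A DA l l] by (simp add: x_def)
  qed
  with nonneg show "0 < A $$ (l, l)" by simp
qed

text \<open>
  Let \<open>x\<close> be column \<open>v\<close> of \<open>A\<close>, so that \<open>x\<^sup>T D x = x v\<close>. If \<open>x v > 0\<close>, every vector is \<open>u + c x\<close> with
  \<open>u v = 0\<close>; the mixed term \<open>u\<^sup>T D x = u v\<close> vanishes, and both remaining terms are nonnegative. That
  would make \<open>D\<close> positive semidefinite.
\<close>

lemma inverse_diagonal_nonpos_if_indefinite:
  fixes A D :: "real mat"
  assumes A: "A \<in> carrier_mat m m" and D: "D \<in> carrier_mat m m"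
    and DA: "D * A = 1\<^sub>m m" and sym: "symmetric_on m D"
    and psd: "psd_on ({..<m} - {v}) D" and indef: "\<not> psd_on {..<m} D" and v: "v < m"
  shows "A $$ (v, v) \<le> 0"
proof (rule ccontr)
  define x where "x j = A $$ (j, v)" for j
  assume "\<not> A $$ (v, v) \<le> 0"
  then have xv: "x v > 0" by (simp add: x_def)
  obtain y where y: "bilin {..<m} D y y < 0"
    using indef unfolding psd_on_def bilin_def by (auto simp: not_le)
  define c where "c = y v / x v"
  define u where "u j = y j - c * x j" for j
  have uv: "u v = 0" using xv by (simp add: u_def c_def)
  have "0 \<le> (\<Sum>i\<in>{..<m} - {v}. \<Sum>j\<in>{..<m} - {v}. D $$ (i, j) * u i * u j)"
    using psd unfolding psd_on_def by blast
  also have "\<dots> = bilin {..<m} D u u"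
    unfolding bilin_def using uv
    by (intro sum.mono_neutral_cong_left) (auto intro!: sum.mono_neutral_left)
  finally have "0 \<le> bilin {..<m} D u u" .
  moreover have "bilin {..<m} D u x = 0" "bilin {..<m} D x x = x v"
    unfolding x_def inverse_column_value[OF A D DA v] using uv by simp_all
  moreover have "bilin {..<m} D y y =
      bilin {..<m} D u u + 2 * c * bilin {..<m} D u x + c\<^sup>2 * bilin {..<m} D x x"
    using bilin_add_scaled[OF sym, of u c x] by (simp add: u_def)
  moreover have "0 \<le> c\<^sup>2 * x v" using xv by simp
  ultimately show False using y by simp
qed

text \<open>
  The restriction of \<open>G\<close> to \<open>X\<close> has a right inverse that is a \<open>Z\<close>-matrix. Stating this for a set of
  indices lets it be carried from the rows of a permuted block to the vertices of a tree.
\<close>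

definition has_Z_inverse_on :: "nat set \<Rightarrow> (nat \<Rightarrow> nat \<Rightarrow> real) \<Rightarrow> bool" where
  "has_Z_inverse_on X G \<longleftrightarrow> (\<exists>D.
     (\<forall>i\<in>X. \<forall>l\<in>X. (\<Sum>j\<in>X. G i j * D j l) = of_bool (i = l)) \<and>
     (\<forall>j\<in>X. \<forall>l\<in>X. j \<noteq> l \<longrightarrow> D j l \<le> 0))"

lemma has_Z_inverse_on_reindex:
  assumes h: "bij_betw h Y X" and inv: "has_Z_inverse_on Y (\<lambda>i j. G (h i) (h j))"
  shows "has_Z_inverse_on X G"
proof -
  obtain D where D: "\<forall>i\<in>Y. \<forall>l\<in>Y. (\<Sum>j\<in>Y. G (h i) (h j) * D j l) = of_bool (i = l)"
    and Z: "\<forall>j\<in>Y. \<forall>l\<in>Y. j \<noteq> l \<longrightarrow> D j l \<le> 0"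
    using inv unfolding has_Z_inverse_on_def by blast
  define g where "g = the_inv_into Y h"
  have inj: "inj_on h Y" and X: "X = h ` Y" using h by (auto simp: bij_betw_def)
  have gh: "g (h i) = i" if "i \<in> Y" for i
    unfolding g_def using that inj by (simp add: the_inv_into_f_f)
  show ?thesis
    unfolding has_Z_inverse_on_def
  proof (intro exI conjI ballI impI)
    fix i l assume "i \<in> X" "l \<in> X"
    then obtain a b where ab: "a \<in> Y" "i = h a" "b \<in> Y" "l = h b" using X by auto
    have "(\<Sum>j\<in>X. G i j * D (g j) (g l)) = (\<Sum>j\<in>Y. G i (h j) * D (g (h j)) (g l))"
      by (rule sum.reindex_bij_betw[OF h, symmetric])
    also have "\<dots> = (\<Sum>j\<in>Y. G (h a) (h j) * D j b)"
      using ab by (intro sum.cong refl) (simp add: gh)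
    also have "\<dots> = of_bool (i = l)"
      using D ab inj by (simp add: inj_on_eq_iff)
    finally show "(\<Sum>j\<in>X. G i j * D (g j) (g l)) = of_bool (i = l)" .
  next
    fix j l assume "j \<in> X" "l \<in> X" and neq: "j \<noteq> l"
    then obtain a b where ab: "a \<in> Y" "j = h a" "b \<in> Y" "l = h b" using X by auto
    then have "a \<noteq> b" using neq by blast
    then show "D (g j) (g l) \<le> 0" using Z ab by (simp add: gh)
  qed
qed

lemma has_Z_inverse_on_if_mat_inverse:
  fixes A D :: "real mat"
  assumes "A \<in> carrier_mat m m" "D \<in> carrier_mat m m" "A * D = 1\<^sub>m m"
    and "\<And>i j. i < m \<Longrightarrow> j < m \<Longrightarrow> i \<noteq> j \<Longrightarrow> D $$ (i, j) \<le> 0"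
  shows "has_Z_inverse_on {..<m} (\<lambda>i j. A $$ (i, j))"
  unfolding has_Z_inverse_on_def
  using assms(4) inverse_pair_sums[OF assms(1-3)]
  by (intro exI[of _ "\<lambda>i j. D $$ (i, j)"]) simp

lemma symmetric_inverse_M_matrix:
  assumes M: "inverse_M_matrix m A" and sym: "symmetric_on m A"
  shows "has_Z_inverse_on {..<m} (\<lambda>i j. A $$ (i, j))"
    and "\<And>i j. i < m \<Longrightarrow> j < m \<Longrightarrow> 0 \<le> A $$ (i, j)"
    and "\<And>i. i < m \<Longrightarrow> 0 < A $$ (i, i)"
proof -
  obtain D where A: "A \<in> carrier_mat m m" and inv: "inverts_mat A D" "inverts_mat D A"
    and L: "D \<in> L_class m m"
    using M unfolding inverse_M_matrix_def M_matrix_def by blast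
  have D: "D \<in> carrier_mat m m" using L unfolding L_class_def by auto
  have AD: "A * D = 1\<^sub>m m" and DA: "D * A = 1\<^sub>m m" using inv A D unfolding inverts_mat_def by auto
  have symD: "symmetric_on m D" by (rule symmetric_inverse[OF A D AD sym])
  have Z: "D $$ (i, j) \<le> 0" if "i < m" "j < m" "i \<noteq> j" for i j
    using off_diagonal_nonpos_if_L_class[OF L that] .
  have "psd_on {..<m} D"
    using L L_class_iff_psd_on[OF D symD Z, of m] by simp
  note A_pos = inverse_nonneg_if_psd_Z[OF A D AD DA symD Z this]
  show "has_Z_inverse_on {..<m} (\<lambda>i j. A $$ (i, j))"
    by (rule has_Z_inverse_on_if_mat_inverse[OF A D AD Z])
  show "0 \<le> A $$ (i, j)" if "i < m" "j < m" for i j using A_pos(1) that by blast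
  show "0 < A $$ (i, i)" if "i < m" for i using A_pos(2) that by blast
qed

lemma symmetric_inverse_N0_matrix:
  assumes N0: "inverse_N0_matrix m A" and sym: "symmetric_on m A"
  shows "has_Z_inverse_on {..<m} (\<lambda>i j. A $$ (i, j))"
    and "\<And>i. i < m \<Longrightarrow> A $$ (i, i) \<le> 0"
proof -
  obtain D where A: "A \<in> carrier_mat m m" and inv: "inverts_mat A D" "inverts_mat D A"
    and m: "1 \<le> m" and L: "D \<in> L_class m (m - 1)"
    using N0 unfolding inverse_N0_matrix_def N0_matrix_def by blast
  have D: "D \<in> carrier_mat m m" using L unfolding L_class_def by auto
  have AD: "A * D = 1\<^sub>m m" and DA: "D * A = 1\<^sub>m m" using inv A D unfolding inverts_mat_def by auto
  have symD: "symmetric_on m D" by (rule symmetric_inverse[OF A D AD sym])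
  have Z: "D $$ (i, j) \<le> 0" if "i < m" "j < m" "i \<noteq> j" for i j
    using off_diagonal_nonpos_if_L_class[OF L that] .
  have psd: "psd_on I D" if "I \<subseteq> {..<m}" "card I = m - 1" for I
    using L L_class_iff_psd_on[OF D symD Z, of "m - 1"] that by simp
  obtain I where I: "I \<subseteq> {..<m}" "card I = m - 1 + 1" "\<not> psd_on I D"
    using L L_class_iff_psd_on[OF D symD Z, of "m - 1"] m by auto
  have "I = {..<m}" using I(1,2) m by (intro card_subset_eq) auto
  then have indef: "\<not> psd_on {..<m} D" using I(3) by simp
  show "A $$ (i, i) \<le> 0" if "i < m" for i
    using that by (intro inverse_diagonal_nonpos_if_indefinite[OF A D DA symD psd indef]) auto
  show "has_Z_inverse_on {..<m} (\<lambda>i j. A $$ (i, j))"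
    by (rule has_Z_inverse_on_if_mat_inverse[OF A D AD Z])
qed

section \<open>Parents and paths to the root\<close>

lemma path_in_altdef:
  "path_in V E p \<longleftrightarrow> p \<noteq> [] \<and> distinct p \<and> set p \<subseteq> V \<and> successively (\<lambda>a b. {a, b} \<in> E) p"
  by (simp add: path_in_def successively_conv_nth)

text \<open>
  The vertex from which the depth-first search discovers \<open>k\<close>; the parent of vertex 1 is the added root 0.
\<close>

definition parent :: "nat \<Rightarrow> nat set set \<Rightarrow> nat \<Rightarrow> nat" where
  "parent n E k = (if k \<le> 1 then 0 else Max {r \<in> {1..<k}. \<exists>v\<in>{k..n}. {r, v} \<in> E})"

text \<open>
  A path from 1 to \<open>k\<close> has to leave the set of vertices numbered before \<open>k\<close>. This makes the maximum in
  the definition of the parent a maximum over a nonempty set.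
\<close>

lemma tree_edge_between_prefix_and_rest:
  fixes k n :: nat
  assumes "connected_graph {1..n} E" and k: "k \<in> {2..n}"
  shows "{r \<in> {1..<k}. \<exists>v\<in>{k..n}. {r, v} \<in> E} \<noteq> {}"
proof
  assume *: "{r \<in> {1..<k}. \<exists>v\<in>{k..n}. {r, v} \<in> E} = {}"
  obtain p where p: "path_between {1..n} E 1 k p"
    using assms unfolding connected_graph_def by fastforce
  have "successively (\<lambda>a b. {a, b} \<in> E) q \<Longrightarrow> set q \<subseteq> {1..n} \<Longrightarrow> q \<noteq> [] \<Longrightarrow> hd q < k \<Longrightarrow> last q < k" for q
  proof (induction q)
    case (Cons a q)
    then show ?case
    proof (cases "q = []")
      case False
      then have edge: "{a, hd q} \<in> E" and "a \<in> {1..<k}"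
        using Cons.prems by (auto simp: successively_Cons)
      have "hd q \<in> {1..n}" using Cons.prems(2) hd_in_set[OF False] by (simp only: list.set) blast
      have "hd q < k"
      proof (rule ccontr)
        assume "\<not> hd q < k"
        then have "a \<in> {r \<in> {1..<k}. \<exists>v\<in>{k..n}. {r, v} \<in> E}"
          using edge \<open>a \<in> {1..<k}\<close> \<open>hd q \<in> {1..n}\<close> by auto
        then show False unfolding * by blast
      qed
      then show ?thesis using Cons False by (auto simp: successively_Cons)
    qed simp
  qed simp
  from this[of p] p k show False
    by (auto simp: path_between_def path_in_altdef)
qed

text \<open>
  The guard makes the recursion terminate for an arbitrary \<open>p\<close>.
\<close>

function root_path :: "(nat \<Rightarrow> nat) \<Rightarrow> nat \<Rightarrow> nat list" where
  "root_path p k = (if p k < k then k # root_path p (p k) else [k])"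
  by auto
termination by (relation "measure snd") auto

declare root_path.simps [simp del]

lemma root_path_0 [simp]: "root_path p 0 = [0]"
  by (subst root_path.simps) simp

lemma root_path_step: "p k < k \<Longrightarrow> root_path p k = k # root_path p (p k)"
  by (subst root_path.simps) simp

lemma hd_in_root_path: "hd (root_path p k) = k" "k \<in> set (root_path p k)" "root_path p k \<noteq> []"
  by (subst root_path.simps, simp)+

context
  fixes n :: nat and E :: "nat set set"
  assumes tree: "tree_graph {1..n} E" and dfs: "dfs_numbered n E"
begin

abbreviation "par \<equiv> parent n E"

lemma parent_props:
  assumes k: "k \<in> {2..n}"
  shows "par k \<in> {1..<k}" "{par k, k} \<in> E"
    "\<And>r v. r \<in> {1..<k} \<Longrightarrow> v \<in> {k..n} \<Longrightarrow> {r, v} \<in> E \<Longrightarrow> r \<le> par k"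
proof -
  let ?R = "{r \<in> {1..<k}. \<exists>v\<in>{k..n}. {r, v} \<in> E}"
  have fin: "finite ?R" by simp
  have ne: "?R \<noteq> {}"
    using tree k by (intro tree_edge_between_prefix_and_rest) (auto simp: tree_graph_def)
  have par: "par k = Max ?R" using k by (simp add: parent_def)
  show "par k \<in> {1..<k}" unfolding par using Max_in[OF fin ne] by blast
  show "{par k, k} \<in> E" unfolding par using dfs k unfolding dfs_numbered_def by blast
  show "r \<le> par k" if "r \<in> {1..<k}" "v \<in> {k..n}" "{r, v} \<in> E" for r v
    unfolding par using that by (intro Max_ge[OF fin]) auto
qed

lemma parent_less: "k \<in> {1..n} \<Longrightarrow> par k < k"
  using parent_props(1)[of k] by (cases "k = 1") (auto simp: parent_def)

text \<open>
  While the neighbour \<open>b\<close> of \<open>a\<close> is not yet visited, \<open>a\<close> still has an unvisited neighbour, so every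
  vertex after \<open>a\<close> and up to \<open>b\<close> is discovered from \<open>a\<close> or from a later vertex. Following parents from
  such a vertex therefore ends in \<open>a\<close>.
\<close>

lemma dfs_descending_path:
  assumes a: "a \<in> {1..n}" and b: "b \<in> {1..n}" "a < b" and ab: "{a, b} \<in> E"
  shows "a \<le> k \<Longrightarrow> k \<le> b \<Longrightarrow> \<exists>q. q \<noteq> [] \<and> hd q = k \<and> last q = a \<and> set q \<subseteq> {a..k} \<and>
    distinct q \<and> successively (\<lambda>u v. {u, v} \<in> E) q \<and> (a < k \<longrightarrow> (\<exists>q'. q = k # par k # q'))"
proof (induction k rule: less_induct)
  case (less k)
  show ?case
  proof (cases "k = a")
    case True
    then show ?thesis by (intro exI[of _ "[a]"]) auto
  next
    case False
    then have k: "k \<in> {2..n}" and ak: "a < k" using less.prems a b by auto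
    have "a \<le> par k" using parent_props(3)[OF k, of a b] a b ab ak less.prems by auto
    moreover have "par k < k" using parent_props(1)[OF k] by simp
    ultimately obtain q where q: "q \<noteq> []" "hd q = par k" "last q = a" "set q \<subseteq> {a..par k}"
      "distinct q" "successively (\<lambda>u v. {u, v} \<in> E) q"
      using less.IH[of "par k"] less.prems by auto
    have "{k, par k} \<in> E" using parent_props(2)[OF k] by (simp add: insert_commute)
    then show ?thesis
      using q \<open>par k < k\<close> ak
      by (intro exI[of _ "k # q"]) (cases q; auto simp: successively_Cons)
  qed
qed

text \<open>
  Otherwise the edge would close the descending path from \<open>b\<close> to \<open>a\<close> to a cycle: the second vertex
  of this path is the parent of \<open>b\<close>, which differs from \<open>a\<close>, so there are at least three vertices.
\<close>

lemma tree_edge_is_parent_edge: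
  assumes a: "a \<in> {1..n}" and b: "b \<in> {1..n}" "a < b" and ab: "{a, b} \<in> E"
  shows "a = par b"
proof (rule ccontr)
  assume neq: "a \<noteq> par b"
  obtain q q' where q: "q \<noteq> []" "hd q = b" "last q = a" "set q \<subseteq> {a..b}"
    "distinct q" "successively (\<lambda>u v. {u, v} \<in> E) q" and q': "q = b # par b # q'"
    using dfs_descending_path[OF a b ab less_imp_le[OF b(2)] order_refl] b(2) by blast
  have "3 \<le> length q" using q' q(3) neq by (cases q') auto
  then have "cycle_in {1..n} E q"
    using q a b ab by (auto simp: cycle_in_def path_in_altdef)
  then show False using tree unfolding tree_graph_def forest_graph_def by blast
qed

lemma rooted_edge_is_parent_edge:
  "e \<in> insert {0, 1} E \<Longrightarrow> e \<subseteq> {0..n} \<Longrightarrow> \<exists>k\<in>{1..n}. e = {par k, k}"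
proof -
  assume e: "e \<in> insert {0, 1} E" "e \<subseteq> {0..n}"
  show ?thesis
  proof (cases "e = {0, 1}")
    case True
    then show ?thesis using e(2) by (intro bexI[of _ 1]) (auto simp: parent_def)
  next
    case False
    then have "e \<in> E" using e by simp
    moreover have "simple_graph {1..n} E" using tree by (simp add: tree_graph_def forest_graph_def)
    ultimately obtain u v where uv: "e = {u, v}" "u \<in> {1..n}" "v \<in> {1..n}" "u \<noteq> v"
      unfolding simple_graph_def by blast
    then consider "u < v" | "v < u" by linarith
    then show ?thesis
    proof cases
      case 1
      then show ?thesis using tree_edge_is_parent_edge[of u v] uv \<open>e \<in> E\<close> by blast
    next
      case 2
      then show ?thesis using tree_edge_is_parent_edge[of v u] uv \<open>e \<in> E\<close>
        by (metis insert_commute)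
    qed
  qed
qed

lemma parent_edge_in:
  assumes "k \<in> {1..n}"
  shows "{par k, k} \<in> insert {0, 1} E"
  using assms parent_props(2)[of k] by (cases "k = 1") (auto simp: parent_def)

text \<open>
  By induction, the path without its first vertex is the chain of parents of its second vertex. If the
  first step led to a child, this chain would come back to the first vertex.
\<close>

lemma path_to_root_unique:
  assumes "successively (\<lambda>a b. {a, b} \<in> insert {0, 1} E) q" "distinct q" "set q \<subseteq> {0..n}"
    "q \<noteq> []" "last q = 0"
  shows "q = root_path par (hd q)"
  using assms
proof (induction q)
  case (Cons a q)
  show ?case
  proof (cases "q = []")
    case True
    then have "a = 0" using Cons.prems by simp
    then show ?thesis using True by simp
  next
    case False
    then have IH: "q = root_path par (hd q)" using Cons by (auto simp: successively_Cons)
    have edge: "{a, hd q} \<in> insert {0, 1} E" using Cons.prems(1) False by (simp add: successively_Cons)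
    have "{a, hd q} \<subseteq> {0..n}"
      using Cons.prems(3) hd_in_set[OF False] by (simp only: list.set) blast
    from rooted_edge_is_parent_edge[OF edge this]
    obtain k where k: "k \<in> {1..n}" "{a, hd q} = {par k, k}" by (elim bexE)
    have "hd q \<noteq> k"
    proof
      assume hq: "hd q = k"
      then have "a = par k" using k parent_less[of k] by (metis doubleton_eq_iff)
      moreover have "par k \<in> set q"
      proof -
        have "q = k # root_path par (par k)"
          using IH k parent_less[of k] by (simp add: hq root_path_step)
        moreover have "par k \<in> set (root_path par (par k))" by (rule hd_in_root_path)
        ultimately show ?thesis by simp
      qed
      ultimately show False using Cons.prems by simp
    qed
    then have "a = k" "hd q = par k" using k(2) by (auto simp: doubleton_eq_iff)
    then show ?thesis using IH k(1) parent_less[of k] by (simp add: root_path_step)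
  qed
qed simp

lemma root_path_is_path:
  "k \<le> n \<Longrightarrow> successively (\<lambda>a b. {a, b} \<in> insert {0, 1} E) (root_path par k) \<and> distinct (root_path par k) \<and>
    set (root_path par k) \<subseteq> {0..k} \<and> hd (root_path par k) = k \<and> last (root_path par k) = 0 \<and> root_path par k \<noteq> []"
proof (induction k rule: less_induct)
  case (less k)
  show ?case
  proof (cases "k = 0")
    case True
    then show ?thesis by simp
  next
    case False
    then have k: "k \<in> {1..n}" using less.prems by simp
    then have lt: "par k < k" using parent_less by simp
    have IH: "successively (\<lambda>a b. {a, b} \<in> insert {0, 1} E) (root_path par (par k))" "distinct (root_path par (par k))"
      "set (root_path par (par k)) \<subseteq> {0..par k}" "hd (root_path par (par k)) = par k" "last (root_path par (par k)) = 0"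
      "root_path par (par k) \<noteq> []"
      using less.IH[OF lt] lt less.prems by auto
    have eq: "root_path par k = k # root_path par (par k)" using lt by (rule root_path_step)
    have "{k, par k} \<in> insert {0, 1} E" using parent_edge_in[OF k] by (metis insert_commute)
    then show ?thesis unfolding eq using IH lt by (auto simp: successively_Cons)
  qed
qed

lemma tree_path_to_root:
  assumes k: "k \<le> n"
  shows "tree_path {0..n} (insert {0, 1} E) k 0 = path_edges (root_path par k)"
proof -
  have "path_between {0..n} (insert {0, 1} E) k 0 q \<longleftrightarrow> q = root_path par k" for q
    unfolding path_between_def path_in_altdef
    using path_to_root_unique[of q] root_path_is_path[OF k] k by fastforce
  then show ?thesis by (simp add: tree_path_def)
qed

end

text \<open>
  Vertex 1 plays a special role and is to remain written as \<open>1\<close> in simplification.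
\<close>

declare One_nat_def [simp del]

text \<open>
  An ancestor \<open>k\<close> of a vertex also stands for the edge \<open>{p k, k}\<close> on its path to the root; this is why the
  vertex itself counts as an ancestor and the root 0 does not.
\<close>

definition ancestors :: "(nat \<Rightarrow> nat) \<Rightarrow> nat \<Rightarrow> nat set" where
  "ancestors p k = set (root_path p k) - {0}"

lemma ancestors_0 [simp]: "ancestors p 0 = {}"
  by (simp add: ancestors_def)

lemma finite_ancestors [simp]: "finite (ancestors p k)"
  by (simp add: ancestors_def)

lemma path_edges_Cons:
  assumes "q \<noteq> []"
  shows "path_edges (a # q) = insert {a, hd q} (path_edges q)"
proof -
  have "(\<exists>i. e = {(a # q) ! i, (a # q) ! Suc i} \<and> Suc i < length (a # q)) \<longleftrightarrow>
      e = {a, hd q} \<or> (\<exists>i. e = {q ! i, q ! Suc i} \<and> Suc i < length q)" for e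
  proof
    assume "\<exists>i. e = {(a # q) ! i, (a # q) ! Suc i} \<and> Suc i < length (a # q)"
    then obtain i where "e = {(a # q) ! i, (a # q) ! Suc i}" "Suc i < length (a # q)" by blast
    then show "e = {a, hd q} \<or> (\<exists>i. e = {q ! i, q ! Suc i} \<and> Suc i < length q)"
      using assms by (cases i) (auto simp: hd_conv_nth)
  next
    assume "e = {a, hd q} \<or> (\<exists>i. e = {q ! i, q ! Suc i} \<and> Suc i < length q)"
    then consider "e = {a, hd q}" | i where "e = {q ! i, q ! Suc i}" "Suc i < length q" by blast
    then show "\<exists>i. e = {(a # q) ! i, (a # q) ! Suc i} \<and> Suc i < length (a # q)"
    proof cases
      case 1
      then show ?thesis using assms by (intro exI[of _ 0]) (simp add: hd_conv_nth)
    next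
      case (2 i)
      then show ?thesis by (intro exI[of _ "Suc i"]) simp
    qed
  qed
  note iff = this
  show ?thesis
    unfolding path_edges_def by (rule Set.set_eqI) (simp only: mem_Collect_eq insert_iff iff)
qed

locale rooted_tree =
  fixes n :: nat and p :: "nat \<Rightarrow> nat"
  assumes parent_below: "k \<in> {1..n} \<Longrightarrow> p k < k"
    and parent_pos: "k \<in> {2..n} \<Longrightarrow> 1 \<le> p k"
begin

lemma ancestors_step: "k \<in> {1..n} \<Longrightarrow> ancestors p k = insert k (ancestors p (p k))"
  by (auto simp: ancestors_def root_path_step[of p k, OF parent_below])

lemma ancestors_below: "k \<le> n \<Longrightarrow> ancestors p k \<subseteq> {1..k}"
proof (induction k rule: less_induct)
  case (less k)
  show ?case
  proof (cases "k = 0")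
    case False
    then have k: "k \<in> {1..n}" using less.prems by simp
    then have lt: "p k < k" by (rule parent_below)
    then have "ancestors p (p k) \<subseteq> {1..p k}" using less by simp
    also have "\<dots> \<subseteq> {1..k}" using lt by auto
    finally show ?thesis using k by (simp add: ancestors_step)
  qed simp
qed

lemma self_in_ancestors: "k \<in> {1..n} \<Longrightarrow> k \<in> ancestors p k"
  by (simp add: ancestors_step)

lemma not_in_parent_ancestors: "k \<in> {1..n} \<Longrightarrow> k \<notin> ancestors p (p k)"
  using ancestors_below[of "p k"] parent_below[of k] by auto

lemma parent_vertex: "k \<in> {2..n} \<Longrightarrow> p k \<in> {1..n}"
  using parent_below[of k] parent_pos[of k] by simp

lemma parent_of_1: "1 \<le> n \<Longrightarrow> p 1 = 0"
  using parent_below[of 1] by simp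

lemma ancestors_1: "1 \<le> n \<Longrightarrow> ancestors p 1 = {1}"
  by (simp add: ancestors_step parent_of_1[simplified])

lemma ancestors_closed:
  assumes X: "\<And>k. k \<in> X \<Longrightarrow> k \<in> {2..n} \<Longrightarrow> p k \<in> X"
  shows "k \<le> n \<Longrightarrow> k \<in> X \<Longrightarrow> ancestors p k \<subseteq> X"
proof (induction k rule: less_induct)
  case (less k)
  show ?case
  proof (cases "k \<in> {2..n}")
    case True
    then show ?thesis
      using less.IH[of "p k"] parent_below[of k] X[of k] less.prems by (auto simp: ancestors_step)
  next
    case False
    then have "k = 0 \<or> k = 1" using less.prems by auto
    then show ?thesis using less.prems ancestors_1 by auto
  qed
qed

lemma one_in_ancestors: "k \<in> {1..n} \<Longrightarrow> 1 \<in> ancestors p k"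
proof (induction k rule: less_induct)
  case (less k)
  then show ?case using parent_below[of k] parent_pos[of k] less.IH[of "p k"] ancestors_step[of k]
    by (cases "k = 1") auto
qed

lemma ancestors_mono: "j \<le> n \<Longrightarrow> i \<in> ancestors p j \<Longrightarrow> ancestors p i \<subseteq> ancestors p j"
proof (induction j rule: less_induct)
  case (less j)
  then have "j \<in> {1..n}" by (cases "j = 0") auto
  then show ?case using less ancestors_step[of j] parent_below[of j] by auto
qed

lemma path_edges_root_path: "k \<le> n \<Longrightarrow> path_edges (root_path p k) = (\<lambda>k. {p k, k}) ` ancestors p k"
proof (induction k rule: less_induct)
  case (less k)
  show ?case
  proof (cases "k = 0")
    case True
    then show ?thesis by (simp add: path_edges_def)
  next
    case False
    then have k: "k \<in> {1..n}" using less.prems by simp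
    show ?thesis
      using less.IH[of "p k"] parent_below[OF k] k
      by (simp add: root_path_step path_edges_Cons hd_in_root_path ancestors_step insert_commute)
  qed
qed

lemma inj_on_parent_edge: "inj_on (\<lambda>k. {p k, k}) {1..n}"
proof (rule inj_onI)
  fix k l assume "k \<in> {1..n}" "l \<in> {1..n}" "{p k, k} = {p l, l}"
  then show "k = l" using parent_below[of k] parent_below[of l] by (auto simp: doubleton_eq_iff)
qed

lemma telescope_ancestors:
  fixes f :: "nat \<Rightarrow> real"
  shows "k \<le> n \<Longrightarrow> (\<Sum>l\<in>ancestors p k. f l - f (p l)) = f k - f 0"
proof (induction k rule: less_induct)
  case (less k)
  show ?case
  proof (cases "k = 0")
    case False
    then have k: "k \<in> {1..n}" using less.prems by simp
    then show ?thesis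
      using less.IH[of "p k"] parent_below[OF k] not_in_parent_ancestors[OF k]
      by (simp add: ancestors_step)
  qed simp
qed

end

section \<open>Green matrix and Laplacian of a weighted tree\<close>

locale weighted_tree = rooted_tree +
  fixes \<omega> :: "nat \<Rightarrow> real"
begin

text \<open>
  The matrix entries of a matrix of tree structure. The name refers to the discrete Green function:
  this matrix turns out to be the inverse of the Laplacian below.
\<close>

definition green :: "nat \<Rightarrow> nat \<Rightarrow> real" where
  "green i j = (\<Sum>k\<in>ancestors p i \<inter> ancestors p j. \<omega> k)"

text \<open>
  Row \<open>k\<close> of the inverse of \<open>U\<close>: it maps a function on the vertices to its increment along the edge
  \<open>{p k, k}\<close>.
\<close>

definition incidence :: "nat \<Rightarrow> nat \<Rightarrow> real" where
  "incidence k i = of_bool (i = k) - of_bool (i = p k)"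

definition laplacian :: "nat \<Rightarrow> nat \<Rightarrow> real" where
  "laplacian i j = (\<Sum>k\<in>{1..n}. incidence k i * incidence k j / \<omega> k)"

lemma sum_incidence_vertices:
  assumes "X \<subseteq> {1..n}" "k \<in> {1..n}"
  shows "(\<Sum>i\<in>X. f i * incidence k i) =
    (if k \<in> X then f k else 0) - (if p k \<in> X then f (p k) else 0)"
proof -
  have fin: "finite X" using assms(1) finite_subset by blast
  have "(\<Sum>i\<in>X. f i * incidence k i) =
      (\<Sum>i\<in>X. (if i = k then f i else 0) - (if i = p k then f i else 0))"
    by (intro sum.cong refl) (simp add: incidence_def)
  then show ?thesis using fin by (simp add: sum_subtractf)
qed

lemma sum_incidence_path:
  assumes "i \<le> n" "l \<in> {1..n}"
  shows "(\<Sum>k\<in>ancestors p i. incidence k l) = of_bool (i = l)"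
proof -
  have "(\<Sum>k\<in>ancestors p i. incidence k l) =
      (\<Sum>k\<in>ancestors p i. of_bool (k = l) - of_bool (p k = l))"
    by (intro sum.cong refl) (simp add: incidence_def eq_commute)
  also have "\<dots> = of_bool (i = l)"
    using telescope_ancestors[OF assms(1), of "\<lambda>k. of_bool (k = l)"] assms(2) by simp
  finally show ?thesis .
qed

lemma green_commute: "green i j = green j i"
  by (simp add: green_def Int_commute)

lemma laplacian_commute: "laplacian i j = laplacian j i"
  by (simp add: laplacian_def mult.commute)

lemma green_altdef:
  assumes "i \<le> n"
  shows "green i j = (\<Sum>k\<in>{1..n}. of_bool (k \<in> ancestors p i) * of_bool (k \<in> ancestors p j) * \<omega> k)"
proof -
  have "(\<Sum>k\<in>{1..n}. of_bool (k \<in> ancestors p i) * of_bool (k \<in> ancestors p j) * \<omega> k) = 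
    (\<Sum>k\<in>{1..n}. if k \<in> ancestors p i \<inter> ancestors p j then \<omega> k else 0)"
    by (intro sum.cong) auto
  also have "\<dots> = (\<Sum>k\<in>{1..n} \<inter> (ancestors p i \<inter> ancestors p j). \<omega> k)"
    by (simp add: sum.inter_restrict)
  also have "{1..n} \<inter> (ancestors p i \<inter> ancestors p j) = ancestors p i \<inter> ancestors p j"
    using ancestors_below[OF assms] assms by auto
  finally show ?thesis by (simp add: green_def)
qed

text \<open>
  In matrix form, this is \<open>(U diag(\<omega>) U\<^sup>T) (N\<^sup>T diag(1 / \<omega>) N) = U N = 1\<close>, where \<open>N\<close> is the incidence
  matrix and \<open>N\<close> is the inverse of \<open>U\<close>.
\<close>

lemma green_laplacian_inverse:
  assumes nz: "\<And>k. k \<in> {1..n} \<Longrightarrow> \<omega> k \<noteq> 0" and i: "i \<in> {1..n}" and l: "l \<in> {1..n}"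
  shows "(\<Sum>j\<in>{1..n}. green i j * laplacian j l) = of_bool (i = l)"
proof -
  let ?V = "{1..n}" and ?u = "\<lambda>i k. of_bool (k \<in> ancestors p i) :: real"
  have dual: "(\<Sum>j\<in>?V. ?u j k * incidence k' j) = of_bool (k = k')" if "k \<in> ?V" "k' \<in> ?V" for k k'
  proof -
    have "(\<Sum>j\<in>?V. ?u j k * incidence k' j) = ?u k' k - ?u (p k') k"
      using sum_incidence_vertices[OF order_refl that(2), of "\<lambda>j. ?u j k"] that parent_below[of k']
      by (cases "p k' = 0") auto
    also have "\<dots> = of_bool (k = k')"
      using that ancestors_step[of k'] not_in_parent_ancestors[of k'] by auto
    finally show ?thesis .
  qed
  have "(\<Sum>j\<in>?V. green i j * laplacian j l) =
    (\<Sum>j\<in>?V. \<Sum>k\<in>?V. \<Sum>k'\<in>?V. (?u i k * \<omega> k * incidence k' l / \<omega> k') * (?u j k * incidence k' j))"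
    using i unfolding laplacian_def
    by (simp add: green_altdef sum_product) (intro sum.cong refl; simp add: field_simps)
  also have "\<dots> = (\<Sum>k\<in>?V. \<Sum>k'\<in>?V. \<Sum>j\<in>?V. (?u i k * \<omega> k * incidence k' l / \<omega> k') * (?u j k * incidence k' j))"
    by (subst sum.swap) (intro sum.cong refl sum.swap)
  also have "\<dots> = (\<Sum>k\<in>?V. \<Sum>k'\<in>?V. (?u i k * \<omega> k * incidence k' l / \<omega> k') * of_bool (k = k'))"
    unfolding sum_distrib_left[symmetric]
    by (intro sum.cong refl arg_cong2[where f = "(*)"] dual)
  also have "\<dots> = (\<Sum>k\<in>?V. if k \<in> ancestors p i then incidence k l else 0)"
    using nz by (intro sum.cong refl) (simp add: of_bool_def if_distrib cong: if_cong)
  also have "\<dots> = (\<Sum>k\<in>?V \<inter> ancestors p i. incidence k l)"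
    by (simp add: sum.inter_restrict)
  also have "?V \<inter> ancestors p i = ancestors p i"
    using ancestors_below[of i] i by auto
  also have "(\<Sum>k\<in>ancestors p i. incidence k l) = of_bool (i = l)"
    using i l by (intro sum_incidence_path) auto
  finally show ?thesis .
qed

text \<open>
  The extension of \<open>y\<close> by 0, called \<open>z\<close>, also takes care of the root, where the increment along
  \<open>{0, 1}\<close> needs the value 0.
\<close>

lemma laplacian_form:
  assumes I: "I \<subseteq> {1..n}" and z: "\<And>i. z i = (if i \<in> I then y i else 0)"
  shows "(\<Sum>i\<in>I. \<Sum>j\<in>I. laplacian i j * y i * y j) = (\<Sum>k\<in>{1..n}. (z k - z (p k))\<^sup>2 / \<omega> k)"
proof -
  have "(\<Sum>i\<in>I. \<Sum>j\<in>I. laplacian i j * y i * y j) =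
     (\<Sum>i\<in>I. \<Sum>j\<in>I. \<Sum>k\<in>{1..n}. (y i * incidence k i) * (y j * incidence k j) / \<omega> k)"
    by (simp add: laplacian_def sum_distrib_right sum_distrib_left algebra_simps)
  also have "\<dots> = (\<Sum>i\<in>I. \<Sum>k\<in>{1..n}. \<Sum>j\<in>I. (y i * incidence k i) * (y j * incidence k j) / \<omega> k)"
    by (intro sum.cong refl sum.swap)
  also have "\<dots> = (\<Sum>k\<in>{1..n}. \<Sum>i\<in>I. \<Sum>j\<in>I. (y i * incidence k i) * (y j * incidence k j) / \<omega> k)"
    by (rule sum.swap)
  also have "\<dots> = (\<Sum>k\<in>{1..n}. (\<Sum>i\<in>I. y i * incidence k i)\<^sup>2 / \<omega> k)"
    by (simp add: power2_eq_square sum_product sum_divide_distrib)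
  also have "\<dots> = (\<Sum>k\<in>{1..n}. (z k - z (p k))\<^sup>2 / \<omega> k)"
    by (intro sum.cong refl) (simp add: sum_incidence_vertices[OF I] z)
  finally show ?thesis .
qed

lemma incidence_off_diagonal:
  assumes "i \<in> {1..n}" "j \<in> {1..n}" "i \<noteq> j" "k \<in> {1..n}" "incidence k i * incidence k j \<noteq> 0"
  shows "{i, j} = {p k, k}" "k \<in> {2..n}" "incidence k i * incidence k j = -1"
proof -
  have "i = k \<and> j = p k \<or> i = p k \<and> j = k"
    using assms by (auto simp: incidence_def split: if_splits)
  moreover from this have "p k \<noteq> 0" using assms by auto
  then have "k \<noteq> 1" using parent_of_1 assms by auto
  ultimately show "{i, j} = {p k, k}" "k \<in> {2..n}" "incidence k i * incidence k j = -1"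
    using assms parent_below[of k] by (auto simp: incidence_def)
qed

lemma laplacian_off_diagonal_nonpos:
  assumes "\<And>k. k \<in> {2..n} \<Longrightarrow> \<omega> k > 0" "i \<in> {1..n}" "j \<in> {1..n}" "i \<noteq> j"
  shows "laplacian i j \<le> 0"
  unfolding laplacian_def
proof (rule sum_nonpos)
  fix k assume k: "k \<in> {1..n}"
  show "incidence k i * incidence k j / \<omega> k \<le> 0"
  proof (cases "incidence k i * incidence k j = 0")
    case False
    then show ?thesis
      using incidence_off_diagonal[OF assms(2-4) k False] assms(1)[of k] by simp
  next
    case True
    then show ?thesis by (simp only: div_0 order_refl)
  qed
qed

lemma laplacian_support:
  assumes "laplacian i j \<noteq> 0" "i \<in> {1..n}" "j \<in> {1..n}" "i \<noteq> j"
  shows "\<exists>k\<in>{2..n}. {i, j} = {p k, k}"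
proof -
  obtain k where k: "k \<in> {1..n}" "incidence k i * incidence k j / \<omega> k \<noteq> 0"
    using assms(1) unfolding laplacian_def by (metis (no_types, lifting) sum.neutral)
  then have "incidence k i * incidence k j \<noteq> 0" by auto
  then show ?thesis using incidence_off_diagonal[OF assms(2-4) k(1)] by blast
qed

lemma green_1: "j \<in> {1..n} \<Longrightarrow> green 1 j = \<omega> 1"
  using one_in_ancestors[of j] ancestors_1 by (simp add: green_def)

lemma green_ancestor:
  assumes "j \<in> {1..n}" "i \<in> ancestors p j"
  shows "green i j = green i i"
  using ancestors_mono[of j i] assms by (simp add: green_def Int_absorb2)

lemma green_parent:
  assumes "k \<in> {2..n}"
  shows "green (p k) k = green (p k) (p k)"
  using assms ancestors_step[of k] self_in_ancestors[of "p k"] parent_pos[of k] parent_below[of k]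
  by (intro green_ancestor) auto

lemma green_diff_parent:
  assumes k: "k \<in> {1..n}"
  shows "green k j - green (p k) j = of_bool (k \<in> ancestors p j) * \<omega> k"
proof (cases "k \<in> ancestors p j")
  case True
  then have "ancestors p k \<inter> ancestors p j = insert k (ancestors p (p k) \<inter> ancestors p j)"
    using ancestors_step[OF k] by auto
  then show ?thesis using True not_in_parent_ancestors[OF k] by (simp add: green_def)
next
  case False
  then have "ancestors p k \<inter> ancestors p j = ancestors p (p k) \<inter> ancestors p j"
    using ancestors_step[OF k] by auto
  then show ?thesis using False by (simp add: green_def)
qed

text \<open>
  The rows \<open>k\<close> and \<open>p k\<close> of the Green matrix differ by \<open>\<omega> k\<close> at the descendants of \<open>k\<close> and nowhere else.
  Multiplied with column \<open>p k\<close> of the inverse, the difference of the two rows gives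
  \<open>\<omega> k * d = - 1\<close>, where \<open>d\<close> is a sum of off-diagonal entries of the inverse, hence \<open>d \<le> 0\<close>.
\<close>

lemma weight_pos_if_block_inverse_Z:
  assumes X: "X \<subseteq> {1..n}" and k: "k \<in> {2..n}" "k \<in> X" "p k \<in> X"
    and G: "has_Z_inverse_on X green"
  shows "\<omega> k > 0"
proof -
  obtain D where inv: "\<forall>i\<in>X. \<forall>l\<in>X. (\<Sum>j\<in>X. green i j * D j l) = of_bool (i = l)"
    and Z: "\<forall>j\<in>X. \<forall>l\<in>X. j \<noteq> l \<longrightarrow> D j l \<le> 0"
    using G unfolding has_Z_inverse_on_def by blast
  let ?q = "p k"
  have k1: "k \<in> {1..n}" using k by simp
  have "?q \<noteq> k" using parent_below[OF k1] by simp
  have fin: "finite X" using X finite_subset by blast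
  define d where "d = (\<Sum>j\<in>X. of_bool (k \<in> ancestors p j) * D j ?q)"
  have "\<omega> k * d = (\<Sum>j\<in>X. (green k j - green ?q j) * D j ?q)"
    by (simp add: d_def green_diff_parent[OF k1] sum_distrib_left algebra_simps)
  also have "\<dots> = -1"
    using inv k \<open>?q \<noteq> k\<close> by (simp add: left_diff_distrib sum_subtractf)
  finally have "\<omega> k * d = -1" .
  moreover have "d \<le> 0"
    unfolding d_def
  proof (rule sum_nonpos)
    fix j assume j: "j \<in> X"
    show "of_bool (k \<in> ancestors p j) * D j ?q \<le> 0"
    proof (cases "j = ?q")
      case True
      then show ?thesis using not_in_parent_ancestors[OF k1] by simp
    next
      case False
      then show ?thesis using Z j k(3) by simp
    qed
  qed
  ultimately show ?thesis by (smt (verit) mult_nonpos_nonpos)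
qed

text \<open>energy lower bound\<close>

text \<open>
  Cauchy-Schwarz on the path from 1 to \<open>v\<close>: the squared drop \<open>(z 1)\<^sup>2\<close> is at most the resistance of the
  path times the energy on it, and the resistance is \<open>green v v - \<omega> 1 \<le> - \<omega> 1\<close>.
\<close>

lemma energy_nonneg_if_resistance_le:
  assumes neg: "\<omega> 1 < 0" and pos: "\<And>k. k \<in> {2..n} \<Longrightarrow> \<omega> k > 0"
    and v: "v \<in> {1..n}" "green v v \<le> 0" and z: "z v = 0" "z 0 = 0"
  shows "0 \<le> (\<Sum>k\<in>{1..n}. (z k - z (p k))\<^sup>2 / \<omega> k)"
proof -
  let ?P = "ancestors p v - {1}" and ?W = "{1..n} - {1}"
  have n: "1 \<le> n" using v by simp
  have P: "?P \<subseteq> ?W" "?P \<subseteq> {2..n}" using ancestors_below[of v] v by force+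
  have "(\<Sum>k\<in>ancestors p v. z k - z (p k)) = 0"
    using telescope_ancestors[of v z] v z by simp
  then have drop: "(\<Sum>k\<in>?P. z k - z (p k)) = - z 1"
    using one_in_ancestors[OF v(1)] parent_of_1[OF n] z(2) by (simp add: sum_diff1)
  have "green v v = (\<Sum>k\<in>ancestors p v. \<omega> k)" by (simp add: green_def)
  then have length: "(\<Sum>k\<in>?P. \<omega> k) \<le> - \<omega> 1"
    using one_in_ancestors[OF v(1)] v(2) by (simp add: sum_diff1)
  have "(z 1)\<^sup>2 = (\<Sum>k\<in>?P. sqrt (\<omega> k) * ((z k - z (p k)) / sqrt (\<omega> k)))\<^sup>2"
  proof -
    have "(\<Sum>k\<in>?P. sqrt (\<omega> k) * ((z k - z (p k)) / sqrt (\<omega> k))) = (\<Sum>k\<in>?P. z k - z (p k))"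
      using pos P(2) by (intro sum.cong refl) force
    then show ?thesis using drop by simp
  qed
  also have "\<dots> \<le> (\<Sum>k\<in>?P. (sqrt (\<omega> k))\<^sup>2) * (\<Sum>k\<in>?P. ((z k - z (p k)) / sqrt (\<omega> k))\<^sup>2)"
    by (rule Cauchy_Schwarz_ineq_sum)
  also have "\<dots> = (\<Sum>k\<in>?P. \<omega> k) * (\<Sum>k\<in>?P. (z k - z (p k))\<^sup>2 / \<omega> k)"
    using pos P(2) by (intro arg_cong2[where f = "(*)"] sum.cong refl)
      (auto simp: power_divide subset_iff less_imp_le)
  also have "\<dots> \<le> - \<omega> 1 * (\<Sum>k\<in>?W. (z k - z (p k))\<^sup>2 / \<omega> k)"
  proof (rule mult_mono[OF length])
    have nonneg: "0 \<le> (z k - z (p k))\<^sup>2 / \<omega> k" if "k \<in> ?W" for k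
      using pos[of k] that by auto
    then show "(\<Sum>k\<in>?P. (z k - z (p k))\<^sup>2 / \<omega> k) \<le> (\<Sum>k\<in>?W. (z k - z (p k))\<^sup>2 / \<omega> k)"
      using P(1) by (intro sum_mono2) auto
    show "0 \<le> (\<Sum>k\<in>?P. (z k - z (p k))\<^sup>2 / \<omega> k)"
      using nonneg P(1) by (intro sum_nonneg) blast
  qed (use neg in simp)
  finally have "(z 1)\<^sup>2 / (- \<omega> 1) \<le> (\<Sum>k\<in>?W. (z k - z (p k))\<^sup>2 / \<omega> k)"
    using neg by (simp add: field_simps)
  moreover have "(\<Sum>k\<in>{1..n}. (z k - z (p k))\<^sup>2 / \<omega> k) =
      (z 1)\<^sup>2 / \<omega> 1 + (\<Sum>k\<in>?W. (z k - z (p k))\<^sup>2 / \<omega> k)"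
    using n parent_of_1[OF n] z(2) by (subst sum.remove[of "{1..n}" 1]) auto
  ultimately show ?thesis by simp
qed

end

section \<open>Trees whose matrix has two diagonal blocks\<close>

text \<open>
  The Green matrix is a symmetric permutation of the given block matrix; \<open>S\<close> and \<open>T\<close> are the
  vertex sets of the diagonal blocks.
\<close>

locale block_tree = weighted_tree +
  fixes S T :: "nat set" and \<tau> :: real
  assumes partition: "S \<union> T = {1..n}" "S \<inter> T = {}" "S \<noteq> {}" "T \<noteq> {}"
    and cross: "\<And>i j. i \<in> S \<Longrightarrow> j \<in> T \<Longrightarrow> green i j = \<tau>"
    and S_diag: "\<And>i. i \<in> S \<Longrightarrow> green i i \<le> 0"
    and \<tau>_le: "\<tau> \<le> 0"
    and S_inv: "has_Z_inverse_on S green"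
    and T_inv: "has_Z_inverse_on T green"
    and T_nonneg: "\<And>i j. i \<in> T \<Longrightarrow> j \<in> T \<Longrightarrow> 0 \<le> green i j"
    and T_diag: "\<And>i. i \<in> T \<Longrightarrow> 0 < green i i"
begin

lemma block_vertices: "i \<in> S \<Longrightarrow> i \<in> {1..n}" "i \<in> T \<Longrightarrow> i \<in> {1..n}"
  unfolding partition(1)[symmetric] by simp_all

lemma in_T_if_not_in_S: "i \<in> {1..n} \<Longrightarrow> i \<notin> S \<Longrightarrow> i \<in> T"
  unfolding partition(1)[symmetric] by simp

lemma not_in_S_if_in_T: "i \<in> T \<Longrightarrow> i \<notin> S"
  using partition(2) by blast

lemma vertices_ge_1: "1 \<le> n" "1 \<in> {1..n}"
proof -
  obtain i where "i \<in> S" using partition(3) by blast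
  then show "1 \<le> n" using block_vertices(1)[of i] by simp
  then show "1 \<in> {1..n}" by simp
qed

text \<open>
  The first row of the Green matrix is constant. If vertex 1 were in \<open>T\<close>, its value would be both a
  positive diagonal entry and \<open>\<tau>\<close>.
\<close>

lemma root_in_S: "1 \<in> S"
proof (rule ccontr)
  assume "1 \<notin> S"
  then have T: "1 \<in> T" using in_T_if_not_in_S vertices_ge_1(2) by blast
  obtain i where i: "i \<in> S" using partition(3) by blast
  then have "green 1 i = \<tau>" using cross[OF i T] green_commute by simp
  then show False using T_diag[OF T] green_1[of 1] green_1[of i] vertices_ge_1 block_vertices(1)[OF i] \<tau>_le by simp
qed

lemma root_weight: "\<omega> 1 = \<tau>"
proof -
  obtain j where j: "j \<in> T" using partition(4) by blast
  then show ?thesis using cross[OF root_in_S j] green_1[OF block_vertices(2)[OF j]] by simp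
qed

lemma root_weight_neg: "\<omega> 1 < 0"
proof -
  have "\<omega> 1 \<noteq> 0"
  proof
    assume zero: "\<omega> 1 = 0"
    obtain D where "\<forall>i\<in>S. \<forall>l\<in>S. (\<Sum>j\<in>S. green i j * D j l) = of_bool (i = l)"
      using S_inv unfolding has_Z_inverse_on_def by (elim exE conjE) (rule that)
    then have "(\<Sum>j\<in>S. green 1 j * D j 1) = 1"
      using root_in_S by simp
    moreover have "(\<Sum>j\<in>S. green 1 j * D j 1) = 0"
      using block_vertices green_1 zero by (intro sum.neutral) simp
    ultimately show False by simp
  qed
  then show ?thesis using root_weight \<tau>_le by simp
qed

text \<open>
  The entry at \<open>(p k, k)\<close> equals the diagonal entry at \<open>p k\<close>. For \<open>p k \<in> T\<close>, it would be both positive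
  and \<open>\<tau>\<close>.
\<close>

lemma parent_in_S:
  assumes "k \<in> S" "k \<in> {2..n}"
  shows "p k \<in> S"
proof (rule ccontr)
  assume "p k \<notin> S"
  then have T: "p k \<in> T" using parent_vertex[OF assms(2)] in_T_if_not_in_S by blast
  then have "green (p k) (p k) = \<tau>"
    using green_parent[OF assms(2)] cross[OF assms(1) T] green_commute by simp
  then show False using T_diag[OF T] \<tau>_le by simp
qed

lemma weight_pos_S:
  assumes "k \<in> S" "k \<in> {2..n}"
  shows "\<omega> k > 0"
  using assms(1) parent_in_S[OF assms] S_inv block_vertices(1)
  by (intro weight_pos_if_block_inverse_Z[OF _ assms(2), of S]) blast+

text \<open>
  The entry at \<open>(p k, k)\<close> is \<open>\<tau>\<close> and also the length of the path from \<open>p k\<close> to the root. Since \<open>\<omega> 1 = \<tau>\<close> and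
  the other edges of this path lie in \<open>S\<close> and have positive weights, there are none. The bound on the
  weight says that the diagonal entry \<open>\<omega> 1 + \<omega> k\<close> at \<open>k\<close> is positive.
\<close>

lemma crossing_edge:
  assumes k: "k \<in> T" and pk: "p k \<in> S"
  shows "p k = 1" "\<omega> k > - \<omega> 1" "k \<in> {2..n}"
proof -
  have "k \<noteq> 1" using k root_in_S not_in_S_if_in_T by blast
  then have k2: "k \<in> {2..n}" using block_vertices(2)[OF k] by auto
  then show "k \<in> {2..n}" .
  have pn: "p k \<in> {1..n}" by (rule parent_vertex[OF k2])
  let ?P = "ancestors p (p k) - {1}"
  have sub: "?P \<subseteq> S" using ancestors_closed[of S "p k"] parent_in_S pk pn by auto
  have pos: "\<omega> l > 0" if "l \<in> ?P" for l
  proof -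
    have "l \<in> S" "l \<noteq> 1" using sub that by blast+
    then show ?thesis using weight_pos_S[of l] block_vertices(1)[of l] by auto
  qed
  have "(\<Sum>l\<in>ancestors p (p k). \<omega> l) = \<omega> 1"
    using green_parent[OF k2] cross[OF pk k] root_weight by (simp add: green_def)
  then have "(\<Sum>l\<in>?P. \<omega> l) = 0" using one_in_ancestors[OF pn] by (simp add: sum_diff1)
  moreover have "(\<Sum>l\<in>?P. \<omega> l) > 0" if "p k \<noteq> 1"
    using that pos self_in_ancestors[OF pn] by (intro sum_pos) auto
  ultimately show p1: "p k = 1" by auto
  have "ancestors p k = {k, 1}" using ancestors_step[of k] p1 k2 ancestors_1 vertices_ge_1 by auto
  then have "green k k = \<omega> k + \<omega> 1" using k2 by (simp add: green_def)
  then show "\<omega> k > - \<omega> 1" using T_diag[OF k] by simp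
qed

lemma weight_pos:
  assumes k: "k \<in> {2..n}"
  shows "\<omega> k > 0"
proof (cases "k \<in> S")
  case True
  then show ?thesis using weight_pos_S k by blast
next
  case False
  then have T: "k \<in> T" using k by (intro in_T_if_not_in_S) auto
  have "p k \<in> S \<union> T" using parent_vertex[OF k] by (simp only: partition(1))
  then show ?thesis
  proof
    assume "p k \<in> S"
    then show ?thesis using crossing_edge(2)[OF T] root_weight_neg by simp
  next
    assume "p k \<in> T"
    then show ?thesis using T T_inv block_vertices(2)
      by (intro weight_pos_if_block_inverse_Z[OF _ k, of T]) blast+
  qed
qed

text \<open>
  Two vertices of \<open>T\<close> in different branches at vertex 1 would have the negative entry \<open>\<omega> 1\<close>.
\<close>

lemma crossing_edge_unique:
  assumes "k \<in> T" "p k \<in> S" "l \<in> T" "p l \<in> S"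
  shows "k = l"
proof (rule ccontr)
  assume neq: "k \<noteq> l"
  have "ancestors p k = {k, 1}" "ancestors p l = {l, 1}"
    using crossing_edge[OF assms(1,2)] crossing_edge[OF assms(3,4)] ancestors_step[of k] ancestors_step[of l]
      ancestors_1 vertices_ge_1 by auto
  then have "ancestors p k \<inter> ancestors p l = {1}"
    using neq crossing_edge(3)[OF assms(1,2)] by auto
  then have "green k l = \<omega> 1" by (simp add: green_def)
  then show False using T_nonneg[OF assms(1,3)] root_weight_neg by simp
qed

text \<open>
  The only edges along which the indicator of \<open>S\<close> changes are the edge to the root and the edge from \<open>S\<close>
  to \<open>T\<close>.
\<close>

lemma energy_indicator_neg:
  assumes z: "\<And>i. z i = of_bool (i \<in> S)"
  shows "(\<Sum>k\<in>{1..n}. (z k - z (p k))\<^sup>2 / \<omega> k) < 0"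
proof -
  define K where "K = {k \<in> T. p k \<in> S}"
  let ?W = "{1..n} - {1}"
  have z0: "z 0 = 0" using block_vertices(1)[of 0] by (auto simp: z)
  have KW: "K \<subseteq> ?W" using crossing_edge(3) by (force simp: K_def)
  have "(\<Sum>k\<in>{1..n}. (z k - z (p k))\<^sup>2 / \<omega> k) = 1 / \<omega> 1 + (\<Sum>k\<in>?W. (z k - z (p k))\<^sup>2 / \<omega> k)"
    using vertices_ge_1 parent_of_1 z0 root_in_S by (subst sum.remove[of "{1..n}" 1]) (auto simp: z)
  also have "(\<Sum>k\<in>?W. (z k - z (p k))\<^sup>2 / \<omega> k) = (\<Sum>k\<in>K. 1 / \<omega> k)"
  proof (rule sum.mono_neutral_cong_right)
    show "\<forall>k\<in>?W - K. (z k - z (p k))\<^sup>2 / \<omega> k = 0"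
    proof
      fix k assume k: "k \<in> ?W - K"
      then have "k \<in> {2..n}" "k \<notin> K" by auto
      then have "k \<in> S \<and> p k \<in> S \<or> k \<notin> S \<and> p k \<notin> S"
        using parent_in_S[of k] in_T_if_not_in_S[of k] by (auto simp: K_def)
      then show "(z k - z (p k))\<^sup>2 / \<omega> k = 0" by (auto simp: z)
    qed
    show "(z k - z (p k))\<^sup>2 / \<omega> k = 1 / \<omega> k" if "k \<in> K" for k
      using that not_in_S_if_in_T by (simp add: z K_def)
  qed (use KW in auto)
  also have "1 / \<omega> 1 + (\<Sum>k\<in>K. 1 / \<omega> k) < 0"
  proof (cases "K = {}")
    case True
    then show ?thesis using root_weight_neg by simp
  next
    case False
    then obtain k where k: "k \<in> T" "p k \<in> S" by (auto simp: K_def)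
    then have "K = {k}" using crossing_edge_unique by (auto simp: K_def)
    moreover have "1 / \<omega> k < 1 / (- \<omega> 1)"
      using crossing_edge(2)[OF k] root_weight_neg by (intro frac_less2) simp_all
    ultimately show ?thesis by simp
  qed
  finally show ?thesis .
qed

end

section \<open>The Laplacian as a matrix\<close>

context weighted_tree
begin

definition laplacian_mat :: "real mat" where
  "laplacian_mat = mat n n (\<lambda>(i, j). laplacian (Suc i) (Suc j))"

lemma laplacian_mat_carrier [simp]:
  "laplacian_mat \<in> carrier_mat n n" "dim_row laplacian_mat = n" "dim_col laplacian_mat = n"
  by (simp_all add: laplacian_mat_def)

lemma laplacian_mat_entry [simp]:
  "i < n \<Longrightarrow> j < n \<Longrightarrow> laplacian_mat $$ (i, j) = laplacian (Suc i) (Suc j)"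
  by (simp add: laplacian_mat_def)

lemma symmetric_laplacian_mat: "symmetric_on n laplacian_mat"
  by (simp add: symmetric_on_def laplacian_commute)

lemma mult_laplacian_mat:
  assumes A: "A \<in> carrier_mat n n"
    and green: "\<And>i j. i < n \<Longrightarrow> j < n \<Longrightarrow> A $$ (i, j) = green (Suc i) (Suc j)"
    and nz: "\<And>k. k \<in> {1..n} \<Longrightarrow> \<omega> k \<noteq> 0"
  shows "A * laplacian_mat = 1\<^sub>m n"
proof (rule eq_matI)
  fix i l assume "i < dim_row (1\<^sub>m n)" "l < dim_col (1\<^sub>m n)"
  then have il: "i < n" "l < n" by auto
  have "(A * laplacian_mat) $$ (i, l) = (\<Sum>j<n. green (Suc i) (Suc j) * laplacian (Suc j) (Suc l))"
    using il A by (simp add: scalar_prod_def lessThan_atLeast0 green laplacian_mat_def)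
  also have "\<dots> = (\<Sum>j\<in>{1..n}. green (Suc i) j * laplacian j (Suc l))"
    by (simp add: One_nat_def sum.atLeast1_atMost_eq)
  also have "\<dots> = of_bool (Suc i = Suc l)"
    using il by (intro green_laplacian_inverse nz) auto
  finally show "(A * laplacian_mat) $$ (i, l) = 1\<^sub>m n $$ (i, l)" using il by simp
qed (use A in \<open>simp_all add: laplacian_mat_def\<close>)

text \<open>
  Matrix positions are counted from 0 and vertices from 1, hence the \<open>Suc\<close>. Restricting to a principal
  submatrix means requiring that the potential vanishes off the corresponding vertices.
\<close>

lemma psd_on_laplacian_mat_iff:
  assumes I: "I \<subseteq> {..<n}"
  shows "psd_on I laplacian_mat \<longleftrightarrow>
    (\<forall>z. (\<forall>i. i \<notin> Suc ` I \<longrightarrow> z i = 0) \<longrightarrow> 0 \<le> (\<Sum>k\<in>{1..n}. (z k - z (p k))\<^sup>2 / \<omega> k))"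
proof -
  have sub: "Suc ` I \<subseteq> {1..n}" using I by auto
  have form: "(\<Sum>i\<in>I. \<Sum>j\<in>I. laplacian_mat $$ (i, j) * z (Suc i) * z (Suc j)) =
      (\<Sum>k\<in>{1..n}. (z k - z (p k))\<^sup>2 / \<omega> k)" if z: "\<forall>i. i \<notin> Suc ` I \<longrightarrow> z i = 0" for z
  proof -
    have "(\<Sum>i\<in>I. \<Sum>j\<in>I. laplacian_mat $$ (i, j) * z (Suc i) * z (Suc j)) =
        (\<Sum>i\<in>I. \<Sum>j\<in>I. laplacian (Suc i) (Suc j) * z (Suc i) * z (Suc j))"
      using I by (intro sum.cong refl) (auto simp: subset_iff)
    also have "\<dots> = (\<Sum>i\<in>Suc ` I. \<Sum>j\<in>Suc ` I. laplacian i j * z i * z j)"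
      by (simp add: sum.reindex)
    also have "\<dots> = (\<Sum>k\<in>{1..n}. (z k - z (p k))\<^sup>2 / \<omega> k)"
      using z by (intro laplacian_form[OF sub]) auto
    finally show ?thesis .
  qed
  show ?thesis
  proof
    assume psd: "psd_on I laplacian_mat"
    show "\<forall>z. (\<forall>i. i \<notin> Suc ` I \<longrightarrow> z i = 0) \<longrightarrow> 0 \<le> (\<Sum>k\<in>{1..n}. (z k - z (p k))\<^sup>2 / \<omega> k)"
    proof (intro allI impI)
      fix z :: "nat \<Rightarrow> real" assume "\<forall>i. i \<notin> Suc ` I \<longrightarrow> z i = 0"
      from form[OF this] psd[unfolded psd_on_def, rule_format, of "\<lambda>i. z (Suc i)"]
      show "0 \<le> (\<Sum>k\<in>{1..n}. (z k - z (p k))\<^sup>2 / \<omega> k)" by (simp only:)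
    qed
  next
    assume *: "\<forall>z. (\<forall>i. i \<notin> Suc ` I \<longrightarrow> z i = 0) \<longrightarrow> 0 \<le> (\<Sum>k\<in>{1..n}. (z k - z (p k))\<^sup>2 / \<omega> k)"
    show "psd_on I laplacian_mat"
      unfolding psd_on_def
    proof
      fix y :: "nat \<Rightarrow> real"
      define z where "z i = (if i \<in> Suc ` I then y (i - 1) else 0)" for i
      have z: "\<forall>i. i \<notin> Suc ` I \<longrightarrow> z i = 0" by (simp add: z_def)
      have "z (Suc i) = y i" if "i \<in> I" for i using that by (simp add: z_def)
      then have "(\<Sum>i\<in>I. \<Sum>j\<in>I. laplacian_mat $$ (i, j) * y i * y j) =
          (\<Sum>i\<in>I. \<Sum>j\<in>I. laplacian_mat $$ (i, j) * z (Suc i) * z (Suc j))"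
        by (intro sum.cong refl) simp
      then show "0 \<le> (\<Sum>i\<in>I. \<Sum>j\<in>I. laplacian_mat $$ (i, j) * y i * y j)"
        using form[OF z] * z by simp
    qed
  qed
qed

end

context block_tree
begin

lemma weight_nonzero: "k \<in> {1..n} \<Longrightarrow> \<omega> k \<noteq> 0"
  using weight_pos[of k] root_weight_neg by (cases "k = 1") auto

lemma laplacian_mat_off_diagonal:
  "i < n \<Longrightarrow> j < n \<Longrightarrow> i \<noteq> j \<Longrightarrow> laplacian_mat $$ (i, j) \<le> 0"
  using laplacian_off_diagonal_nonpos[OF weight_pos, of "Suc i" "Suc j"] by simp

text \<open>
  A set of fewer than \<open>card S\<close> vertices misses a vertex of \<open>S\<close>, where the potential vanishes; for the
  order \<open>card S\<close>, the set \<open>S\<close> itself is the exception.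
\<close>

lemma laplacian_mat_L_class: "laplacian_mat \<in> L_class n (card S - 1)"
proof -
  have finS: "finite S" using partition(1) by (metis finite_Un finite_atLeastAtMost)
  have cardS: "1 \<le> card S" using finS partition(3) by (simp add: One_nat_def Suc_le_eq card_gt_0_iff)
  have "card S \<le> n" using card_mono[of "{1..n}" S] partition(1) by auto
  then have le: "card S - 1 \<le> n" by simp
  have psd: "psd_on I laplacian_mat" if I: "I \<subseteq> {..<n}" "card I = card S - 1" for I
    unfolding psd_on_laplacian_mat_iff[OF I(1)]
  proof (intro allI impI)
    fix z :: "nat \<Rightarrow> real" assume z: "\<forall>i. i \<notin> Suc ` I \<longrightarrow> z i = 0"
    have "finite (Suc ` I)" using I(1) finite_subset by blast
    moreover have "card (Suc ` I) < card S" using I(2) cardS by (simp add: card_image)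
    ultimately have "\<not> S \<subseteq> Suc ` I" using card_mono[of "Suc ` I" S] by auto
    then obtain v where "v \<in> S" "v \<notin> Suc ` I" by blast
    then show "0 \<le> (\<Sum>k\<in>{1..n}. (z k - z (p k))\<^sup>2 / \<omega> k)"
      using z S_diag block_vertices
      by (intro energy_nonneg_if_resistance_le[OF root_weight_neg weight_pos, of v]) auto
  qed
  have "\<exists>I\<subseteq>{..<n}. card I = card S - 1 + 1 \<and> \<not> psd_on I laplacian_mat"
  proof (intro exI conjI)
    let ?I = "(\<lambda>v. v - 1) ` S"
    have Suc_I: "Suc ` ?I = S"
      using block_vertices(1) by (force simp: image_image)
    show sub: "?I \<subseteq> {..<n}" using block_vertices(1) by fastforce
    have "card ?I = card S" using arg_cong[OF Suc_I, of card] by (simp add: card_image)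
    then show "card ?I = card S - 1 + 1" using cardS by simp
    let ?z = "\<lambda>i. of_bool (i \<in> S) :: real"
    have "(\<Sum>k\<in>{1..n}. (?z k - ?z (p k))\<^sup>2 / \<omega> k) < 0"
      by (rule energy_indicator_neg) (rule refl)
    moreover have "\<forall>i. i \<notin> S \<longrightarrow> ?z i = 0" by simp
    ultimately show "\<not> psd_on ?I laplacian_mat"
      unfolding psd_on_laplacian_mat_iff[OF sub] Suc_I by (meson not_le)
  qed
  with psd have "(\<forall>I\<subseteq>{..<n}. card I = card S - 1 \<longrightarrow> psd_on I laplacian_mat) \<and>
    (card S - 1 < n \<longrightarrow> (\<exists>I\<subseteq>{..<n}. card I = card S - 1 + 1 \<and> \<not> psd_on I laplacian_mat))"
    by (intro conjI impI allI)
  then show ?thesis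
    by (rule L_class_iff_psd_on[OF laplacian_mat_carrier(1) symmetric_laplacian_mat
        laplacian_mat_off_diagonal le, THEN iffD2, rotated -1])
qed

end

section \<open>Inverses of matrices of tree structure\<close>

text \<open>
  An edge of the rooted tree is identified with its lower end point, so common edges of two paths to
  the root become common ancestors.
\<close>

lemma tree_structured_imp_green:
  assumes "tree_structured n A"
  obtains E \<omega> where "tree_graph {1..n} E" "dfs_numbered n E" "A \<in> carrier_mat n n"
    "weighted_tree n (parent n E)"
    "\<And>i j. i \<in> {1..n} \<Longrightarrow> j \<in> {1..n} \<Longrightarrow>
      A $$ (i - 1, j - 1) = weighted_tree.green (parent n E) \<omega> i j"
proof -
  obtain E w where tree: "tree_graph {1..n} E" and dfs: "dfs_numbered n E"
    and A: "tree_structured_wrt n E w A"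
    using assms unfolding tree_structured_def by blast
  let ?p = "parent n E"
  interpret weighted_tree n ?p "\<lambda>k. w {?p k, k}"
    using parent_less[OF tree dfs] parent_props(1)[OF tree dfs] by unfold_locales auto
  have "A $$ (i - 1, j - 1) = green i j" if i: "i \<in> {1..n}" and j: "j \<in> {1..n}" for i j
  proof -
    have path: "tree_path {0..n} (insert {0, 1} E) k 0 = (\<lambda>k. {?p k, k}) ` ancestors ?p k"
      if "k \<in> {1..n}" for k
      using tree_path_to_root[OF tree dfs, of k] path_edges_root_path[of k] that by simp
    have sub: "ancestors ?p k \<subseteq> {1..n}" if "k \<in> {1..n}" for k
      using ancestors_below[of k] that by fastforce
    have "A $$ (i - 1, j - 1) = (\<Sum>e \<in> (\<lambda>k. {?p k, k}) ` ancestors ?p i \<inter> (\<lambda>k. {?p k, k}) ` ancestors ?p j. w e)"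
      using A i j unfolding tree_structured_wrt_def by (simp only: path)
    also have "(\<lambda>k. {?p k, k}) ` ancestors ?p i \<inter> (\<lambda>k. {?p k, k}) ` ancestors ?p j =
        (\<lambda>k. {?p k, k}) ` (ancestors ?p i \<inter> ancestors ?p j)"
      using inj_on_image_Int[OF inj_on_parent_edge sub[OF i] sub[OF j]] by (rule sym)
    also have "(\<Sum>e \<in> \<dots>. w e) = green i j"
      unfolding green_def
      by (subst sum.reindex) (auto intro: inj_on_subset[OF inj_on_parent_edge] dest: subsetD[OF sub[OF i]])
    finally show ?thesis .
  qed
  moreover have "A \<in> carrier_mat n n" using A by (simp add: tree_structured_wrt_def)
  ultimately show ?thesis using that tree dfs weighted_tree_axioms by blast
qed

lemma permuted_entry:
  fixes A P :: "real mat"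
  assumes A: "A \<in> carrier_mat n n" and \<sigma>: "\<sigma> permutes {..<n}"
    and P: "P = mat n n (\<lambda>(i, j). if j = \<sigma> i then 1 else 0)" and ij: "i < n" "j < n"
  shows "(P * A * transpose_mat P) $$ (i, j) = A $$ (\<sigma> i, \<sigma> j)"
proof -
  have \<sigma>_less: "\<sigma> k < n" if "k < n" for k using permutes_in_image[OF \<sigma>, of k] that by simp
  have PA: "(P * A) $$ (i, k) = A $$ (\<sigma> i, k)" if "k < n" for k
  proof -
    have "(P * A) $$ (i, k) = (\<Sum>l<n. P $$ (i, l) * A $$ (l, k))"
      using that A ij unfolding P by (simp add: scalar_prod_def lessThan_atLeast0)
    also have "\<dots> = (\<Sum>l<n. if l = \<sigma> i then A $$ (l, k) else 0)"
      using ij by (intro sum.cong refl) (simp add: P)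
    finally show ?thesis using \<sigma>_less[OF ij(1)] by simp
  qed
  have "(P * A * transpose_mat P) $$ (i, j) = (\<Sum>k<n. (P * A) $$ (i, k) * P $$ (j, k))"
    using A ij unfolding P by (simp add: scalar_prod_def lessThan_atLeast0)
  also have "\<dots> = (\<Sum>k<n. if k = \<sigma> j then A $$ (\<sigma> i, k) else 0)"
  proof (intro sum.cong refl)
    fix k assume "k \<in> {..<n}"
    then show "(P * A) $$ (i, k) * P $$ (j, k) = (if k = \<sigma> j then A $$ (\<sigma> i, k) else 0)"
      using ij by (simp add: PA) (simp add: P)
  qed
  also have "\<dots> = A $$ (\<sigma> i, \<sigma> j)" using \<sigma>_less[OF ij(2)] by simp
  finally show ?thesis .
qed

lemma forest_graph_subset:
  assumes "forest_graph V E" "F \<subseteq> E"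
  shows "forest_graph V F"
  using assms unfolding forest_graph_def simple_graph_def cycle_in_def path_in_def by blast

theorem theorem3p3:
  fixes n s :: nat and A P A11 A12 A21 A22 :: "real mat" and \<tau> :: real
  assumes "1 \<le> s" and "s < n"
    and "tree_structured n A"
    and "permutation_mat n P"
    and "P * A * transpose_mat P = four_block_mat A11 A12 A21 A22"
    and "inverse_N0_matrix s A11"
    and "inverse_M_matrix (n - s) A22"
    and "\<tau> = smallest_entry A11"
    and "A12 = \<tau> \<cdot>\<^sub>m (ones_col s * transpose_mat (ones_col (n - s)))"
    and "A21 = \<tau> \<cdot>\<^sub>m (ones_col (n - s) * transpose_mat (ones_col s))"
  shows "invertible_mat A \<and>
    (\<exists>C. inverts_mat A C \<and> inverts_mat C A \<and>
         acyclic_mat C \<and> Z_matrix C \<and> C \<in> L_class n (s - 1))"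
proof -
  obtain E \<omega> where tree: "tree_graph {1..n} E" and dfs: "dfs_numbered n E" and A: "A \<in> carrier_mat n n"
    and wt: "weighted_tree n (parent n E)"
    and entry: "\<And>i j. i \<in> {1..n} \<Longrightarrow> j \<in> {1..n} \<Longrightarrow>
      A $$ (i - 1, j - 1) = weighted_tree.green (parent n E) \<omega> i j"
    using tree_structured_imp_green[OF assms(3)] by metis
  interpret weighted_tree n "parent n E" \<omega> by (rule wt)
  have A_green: "A $$ (i, j) = green (Suc i) (Suc j)" if "i < n" "j < n" for i j
    using entry[of "Suc i" "Suc j"] that by simp
  obtain \<sigma> where \<sigma>: "\<sigma> permutes {..<n}" and P: "P = mat n n (\<lambda>(i, j). if j = \<sigma> i then 1 else 0)"
    using assms(4) unfolding permutation_mat_def by blast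
  have \<sigma>_less: "\<sigma> k < n" if "k < n" for k using permutes_in_image[OF \<sigma>, of k] that by simp
  have A11: "A11 \<in> carrier_mat s s" using assms(6) by (simp add: inverse_N0_matrix_def)
  have A22: "A22 \<in> carrier_mat (n - s) (n - s)" using assms(7) by (simp add: inverse_M_matrix_def)
  have block: "four_block_mat A11 A12 A21 A22 $$ (i, j) = green (Suc (\<sigma> i)) (Suc (\<sigma> j))"
    if "i < n" "j < n" for i j
    using permuted_entry[OF A \<sigma> P that] that \<sigma>_less A_green unfolding assms(5) by simp
  \<comment> \<open>\<open>h\<close> maps row \<open>i\<close> of the permuted matrix to its vertex, and \<open>h'\<close> does this for row \<open>i\<close> of the second block.\<close>
  define h where "h i = Suc (\<sigma> i)" for i
  define h' where "h' i = h (i + s)" for i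
  have inj: "inj h" using permutes_inj[OF \<sigma>] by (auto simp: h_def inj_on_def)
  define S where "S = h ` {..<s}"
  define T where "T = h' ` {..<n - s}"
  have T_alt: "T = h ` {s..<n}"
  proof -
    have "(\<lambda>i. i + s) ` {..<n - s} = {s..<n}"
      using assms(2) by (simp add: lessThan_atLeast0)
    moreover have "T = h ` (\<lambda>i. i + s) ` {..<n - s}" by (simp add: T_def h'_def image_image)
    ultimately show ?thesis by simp
  qed
  have bijS: "bij_betw h {..<s} S" using inj by (auto simp: S_def bij_betw_def inj_on_def)
  have bijT: "bij_betw h' {..<n - s} T" 
    by (auto simp: T_def h'_def bij_betw_def intro!: inj_onI dest!: injD[OF inj])
  have union: "S \<union> T = {1..n}"
  proof -
    have "S \<union> T = h ` {..<n}" unfolding S_def T_alt image_Un[symmetric] using assms(2) by (simp add: ivl_disj_un)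
    also have "\<dots> = Suc ` \<sigma> ` {..<n}" by (simp add: h_def image_image)
    also have "\<dots> = {1..n}" using permutes_image[OF \<sigma>] by (simp add: image_Suc_lessThan)
    finally show ?thesis .
  qed
  have disjoint: "S \<inter> T = {}"
  proof -
    have "S \<inter> T = h ` ({..<s} \<inter> {s..<n})" unfolding S_def T_alt using inj by (simp add: image_Int)
    then show ?thesis by auto
  qed
  have e11: "A11 $$ (i, j) = green (h i) (h j)" if "i < s" "j < s" for i j
    using block[of i j] that A11 A22 assms(2) by (simp add: h_def)
  have e12: "green (h i) (h' j) = \<tau>" if "i < s" "j < n - s" for i j
    using block[of i "j + s"] that A11 A22 assms(2) unfolding assms(9)
    by (simp add: h_def h'_def ones_col_def scalar_prod_def)
  have e22: "A22 $$ (i, j) = green (h' i) (h' j)" if "i < n - s" "j < n - s" for i j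
    using block[of "i + s" "j + s"] that A11 A22 assms(2) by (simp add: h_def h'_def)
  have sym11: "symmetric_on s A11" by (simp add: symmetric_on_def e11 green_commute)
  have sym22: "symmetric_on (n - s) A22" by (simp add: symmetric_on_def e22 green_commute)
  note N0 = symmetric_inverse_N0_matrix[OF assms(6) sym11]
  note M = symmetric_inverse_M_matrix[OF assms(7) sym22]
  have "has_Z_inverse_on {..<s} (\<lambda>i j. green (h i) (h j))"
    using N0(1) e11 by (simp add: has_Z_inverse_on_def)
  then have S_inv: "has_Z_inverse_on S green" by (rule has_Z_inverse_on_reindex[OF bijS])
  have "has_Z_inverse_on {..<n - s} (\<lambda>i j. green (h' i) (h' j))"
    using M(1) e22 by (simp add: has_Z_inverse_on_def)
  then have T_inv: "has_Z_inverse_on T green" by (rule has_Z_inverse_on_reindex[OF bijT])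
  have "\<tau> \<le> A11 $$ (0, 0)"
    unfolding assms(8) smallest_entry_def
  proof (rule Min_le)
    show "finite (elements_mat A11)" by (simp add: elements_mat_def)
    show "A11 $$ (0, 0) \<in> elements_mat A11" using A11 assms(1) by (intro elements_matI) auto
  qed
  then have \<tau>: "\<tau> \<le> 0" using N0(2)[of 0] assms(1) by simp
  interpret block_tree n "parent n E" \<omega> S T \<tau>
  proof
    show "S \<noteq> {}" "T \<noteq> {}" using assms(1,2) by (auto simp: S_def T_def lessThan_empty_iff)
    show "green i j = \<tau>" if "i \<in> S" "j \<in> T" for i j using that e12 by (auto simp: S_def T_def)
    show "green i i \<le> 0" if "i \<in> S" for i using that N0(2) e11 by (auto simp: S_def)
    show "0 \<le> green i j" if "i \<in> T" "j \<in> T" for i j using that M(2) e22 by (auto simp: T_def)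
    show "0 < green i i" if "i \<in> T" for i using that M(3) e22 by (auto simp: T_def)
  qed (use union disjoint \<tau> S_inv T_inv in auto)
  let ?C = laplacian_mat
  have C: "?C \<in> carrier_mat n n" by simp
  have AC: "A * ?C = 1\<^sub>m n" by (rule mult_laplacian_mat[OF A A_green weight_nonzero])
  have CA: "?C * A = 1\<^sub>m n" by (rule mat_mult_left_right_inverse[OF A C AC])
  have inv: "inverts_mat A ?C" "inverts_mat ?C A"
    using AC CA A C by (auto simp: inverts_mat_def)
  have "matrix_graph_edges ?C \<subseteq> E"
  proof
    fix e assume "e \<in> matrix_graph_edges ?C"
    then obtain i j where ij: "e = {i, j}" "i \<in> {1..n}" "j \<in> {1..n}" "i \<noteq> j"
      "?C $$ (i - 1, j - 1) \<noteq> 0 \<or> ?C $$ (j - 1, i - 1) \<noteq> 0"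
      using C unfolding matrix_graph_edges_def by auto
    then have "laplacian i j \<noteq> 0"
      using laplacian_commute[of i j] by (auto simp: laplacian_mat_def)
    then show "e \<in> E"
      using laplacian_support[of i j] ij parent_props(2)[OF tree dfs] by auto
  qed
  then have "forest_graph {1..n} (matrix_graph_edges ?C)"
    using tree forest_graph_subset unfolding tree_graph_def by blast
  then have "acyclic_mat ?C" using C unfolding acyclic_mat_def square_mat.simps by simp
  moreover have "Z_matrix ?C"
    using C laplacian_mat_off_diagonal unfolding Z_matrix_def square_mat.simps by auto
  moreover have "card S = s" using bij_betw_same_card[OF bijS] by simp
  then have "?C \<in> L_class n (s - 1)" using laplacian_mat_L_class by simp
  moreover have "invertible_mat A" using inv A unfolding invertible_mat_def square_mat.simps by auto
  ultimately show ?thesis using inv by blast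
qed

end
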